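(* Let $P = \{x \in \mathbb{R}^n : a_i^\intercal x \leq b_i,\ i \in [m]\}$ be a rational polytope, with $a_i \in \mathbb{Z}^n$ and $b_i \in \mathbb{Z}_{>0}$ for all $i \in [m]$. Then the algorithm $\mathtt{CoveringRadius}(P)$ (described in the context) returns the covering radius $\mu(P)$ of $P$ in time $$\mathcal{O}\left((\|P\|_\infty\, n)^{2n^2(n+2)} \cdot m^{n+2}\right).$$
   Context: Notation: $[m]=\{1,\dots,m\}$. A polytope is a bounded set of the given form (it is full-dimensional since all $b_i>0$). The covering radius $\mu(P)$ is the smallest real $\mu \ge 0$ such that $\mu P + \mathbb{Z}^n = \bigcup_{z\in\mathbb{Z}^n}(\mu P + z) = \mathbb{R}^n$. The polytope $P$ is given by the integer data $(a_i,b_i)_{i\in[m]}$ (an integer facet description), and $$\|P\|_\infty := \max\left(\{\|a_i\|_\infty : i\in[m]\}\cup\{b_i : i \in [m]\}\right).$$ The algorithm $\mathtt{CoveringRadius}(P,\beta_0,\mu_0)$, for parameters $\beta_0,\mu_0>0$, is as follows. Put $\bar L_P := \mathbb{Z}^n \cap ([0,1]^n - \mu_0[-\beta_0,\beta_0]^n)$ (Minkowski difference of sets). 1. Set $\mu_{\max} := 0$. 2. For all $(n+1)$-tuples $z_1,\dots,z_{n+1}$ of not necessarily distinct points in $\bar L_P$, and for all $(n+1)$-tuples $a_{i_1},\dots,a_{i_{n+1}}$ of facet normals from the description of $P$: if $a_{i_1}/b_{i_1},\dots,a_{i_{n+1}}/b_{i_{n+1}}$ are affinely independent, then solve the linear system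 $$\mu = a_{i_1}^\intercal(x-z_1)/b_{i_1} = \dots = a_{i_{n+1}}^\intercal(x-z_{n+1})/b_{i_{n+1}}$$ in the variables $(\mu,x)\in\mathbb{R}\times\mathbb{R}^n$, to obtain its unique solution $(\mu,p)$; if $p \in [0,1]^n$ and $p \notin \operatorname{int}(\mu P) + \bar L_P$, set $\mu_{\max} := \max\{\mu,\mu_{\max}\}$. 3. Return $\mu_{\max}$. The algorithm $\mathtt{CoveringRadius}(P)$ first computes $\|P\|_\infty$ and then runs $\mathtt{CoveringRadius}(P,\beta_0,\mu_0)$ with $\beta_0 = \|P\|_\infty^n\, n!$ and $\mu_0 = n\,\|P\|_\infty^n\, n!$. Running time is measured as the number of elementary (arithmetic and comparison) steps. *)

theory Defs
  imports
    "HOL-Analysis.Analysis"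
    "HOL-Library.Function_Algebras"
    "HOL-Library.Set_Algebras"
    "HOL-Library.Monad_Syntax"
begin

section \<open>Polytopes and the covering radius\<close>

text \<open>
  The dimension \<open>n\<close> varies inside the running time bound, so real \<open>n\<close>-space is the carrier of
  \<^const>\<open>Euclidean_space\<close>, i.e. the functions \<open>nat \<Rightarrow> real\<close> that vanish from index \<open>n\<close> on.
  Coordinates are numbered from 0.
\<close>

abbreviation real_space :: "nat \<Rightarrow> (nat \<Rightarrow> real) set" where
  "real_space n \<equiv> topspace (Euclidean_space n)"

definition integer_lattice :: "nat \<Rightarrow> (nat \<Rightarrow> real) set" where
  "integer_lattice n = {z \<in> real_space n. \<forall>j<n. z j \<in> \<int>}"

definition dilate :: "real \<Rightarrow> (nat \<Rightarrow> real) set \<Rightarrow> (nat \<Rightarrow> real) set" where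
  "dilate \<mu> S = (\<lambda>x j. \<mu> * x j) ` S"

text \<open>The sum of sets below is the Minkowski sum of \<^theory>\<open>HOL-Library.Set_Algebras\<close>.\<close>

definition covering_radius :: "nat \<Rightarrow> (nat \<Rightarrow> real) set \<Rightarrow> real" where
  "covering_radius n S =
    (LEAST \<mu>. 0 \<le> \<mu> \<and> dilate \<mu> S + integer_lattice n = real_space n)"

text \<open>A facet \<open>(a, b)\<close> stands for the inequality \<open>a\<^sup>T x \<le> b\<close>.\<close>

type_synonym 'a facet = "'a list \<times> 'a"

definition integer_facet_description :: "nat \<Rightarrow> int facet list \<Rightarrow> bool" where
  "integer_facet_description n F \<longleftrightarrow> (\<forall>(a, b)\<in>set F. length a = n \<and> 0 < b)"

definition polyhedron_of :: "nat \<Rightarrow> int facet list \<Rightarrow> (nat \<Rightarrow> real) set" where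
  "polyhedron_of n F =
    {x \<in> real_space n. \<forall>(a, b)\<in>set F. (\<Sum>j<n. of_int (a ! j) * x j) \<le> of_int b}"

text \<open>
  The type class notion of boundedness is not the Euclidean one on \<open>nat \<Rightarrow> real\<close>, whose metric
  induces the product topology.
\<close>

definition bounded_set :: "nat \<Rightarrow> (nat \<Rightarrow> real) set \<Rightarrow> bool" where
  "bounded_set n S \<longleftrightarrow> (\<exists>B. \<forall>x\<in>S. \<forall>j<n. \<bar>x j\<bar> \<le> B)"

definition sup_norm :: "int list \<Rightarrow> int" where
  "sup_norm a = Max (abs ` set a)"

definition facet_norm :: "int facet list \<Rightarrow> int" where
  "facet_norm F = Max ((sup_norm \<circ> fst) ` set F \<union> snd ` set F)"


section \<open>Computations that count elementary steps\<close>

text \<open>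
  Programs compute with exact rational numbers. Every arithmetic operation and every comparison
  of numbers costs one step, whatever the size of the numbers. In addition every passage
  through a loop over a list (\<open>map_t\<close>, \<open>fold_t\<close>, \<open>all_t\<close>) costs one step, which pays for the
  loop counter. Moving data is free.
\<close>

datatype 'a timed = Timed (val: 'a) (steps: nat)

definition return :: "'a \<Rightarrow> 'a timed" where
  "return x = Timed x 0"

definition tick :: "'a \<Rightarrow> 'a timed" where
  "tick x = Timed x 1"

definition bind_timed :: "'a timed \<Rightarrow> ('a \<Rightarrow> 'b timed) \<Rightarrow> 'b timed" where
  "bind_timed c f = (case c of Timed x s \<Rightarrow> case f x of Timed y t \<Rightarrow> Timed y (s + t))"

adhoc_overloading Monad_Syntax.bind \<rightleftharpoons> bind_timed

text \<open>Makes the outcome of earlier comparisons available in termination proofs.\<close>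

lemma bind_timed_cong [fundef_cong]:
  assumes "c = c'" and "\<And>x. x = val c' \<Longrightarrow> f x = g x"
  shows "bind_timed c f = bind_timed c' g"
  using assms by (cases c') (simp add: bind_timed_def)

definition add_t :: "rat \<Rightarrow> rat \<Rightarrow> rat timed" (infixl \<open>+\<^sub>t\<close> 65) where "x +\<^sub>t y = tick (x + y)"
definition sub_t :: "rat \<Rightarrow> rat \<Rightarrow> rat timed" (infixl \<open>-\<^sub>t\<close> 65) where "x -\<^sub>t y = tick (x - y)"
definition mul_t :: "rat \<Rightarrow> rat \<Rightarrow> rat timed" (infixl \<open>*\<^sub>t\<close> 70) where "x *\<^sub>t y = tick (x * y)"
definition div_t :: "rat \<Rightarrow> rat \<Rightarrow> rat timed" (infixl \<open>'/\<^sub>t\<close> 70) where "x /\<^sub>t y = tick (x / y)"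
definition eq_t :: "rat \<Rightarrow> rat \<Rightarrow> bool timed" (infix \<open>=\<^sub>t\<close> 50) where "x =\<^sub>t y = tick (x = y)"
definition le_t :: "rat \<Rightarrow> rat \<Rightarrow> bool timed" (infix \<open>\<le>\<^sub>t\<close> 50) where "x \<le>\<^sub>t y = tick (x \<le> y)"
definition less_t :: "rat \<Rightarrow> rat \<Rightarrow> bool timed" (infix \<open><\<^sub>t\<close> 50) where "x <\<^sub>t y = tick (x < y)"

primrec map_t :: "('a \<Rightarrow> 'b timed) \<Rightarrow> 'a list \<Rightarrow> 'b list timed" where
  "map_t f [] = return []"
| "map_t f (x # xs) = do { y \<leftarrow> f x; ys \<leftarrow> map_t f xs; tick (y # ys) }"

primrec fold_t :: "('a \<Rightarrow> 'b \<Rightarrow> 'b timed) \<Rightarrow> 'a list \<Rightarrow> 'b \<Rightarrow> 'b timed" where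
  "fold_t f [] s = return s"
| "fold_t f (x # xs) s = do { s' \<leftarrow> f x s; s'' \<leftarrow> fold_t f xs s'; tick s'' }"

primrec all_t :: "('a \<Rightarrow> bool timed) \<Rightarrow> 'a list \<Rightarrow> bool timed" where
  "all_t p [] = return True"
| "all_t p (x # xs) = do {
     b \<leftarrow> p x;
     b' \<leftarrow> (if b then all_t p xs else return False);
     tick b' }"

definition abs_t :: "rat \<Rightarrow> rat timed" where
  "abs_t x = do { neg \<leftarrow> x <\<^sub>t 0; if neg then 0 -\<^sub>t x else return x }"

definition max_t :: "rat \<Rightarrow> rat \<Rightarrow> rat timed" where
  "max_t x y = do { le \<leftarrow> x \<le>\<^sub>t y; return (if le then y else x) }"

definition power_t :: "rat \<Rightarrow> nat \<Rightarrow> rat timed" where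
  "power_t x k = fold_t (\<lambda>_ y. x *\<^sub>t y) [0..<k] 1"

definition fact_t :: "nat \<Rightarrow> rat timed" where
  "fact_t k = fold_t (\<lambda>i y. of_nat i *\<^sub>t y) [1..<Suc k] 1"

definition diff_t :: "rat list \<Rightarrow> rat list \<Rightarrow> rat list timed" where
  "diff_t xs ys = map_t (\<lambda>(x, y). x -\<^sub>t y) (zip xs ys)"

definition dot_t :: "rat list \<Rightarrow> rat list \<Rightarrow> rat timed" where
  "dot_t xs ys = fold_t (\<lambda>(x, y) s. do { p \<leftarrow> x *\<^sub>t y; s +\<^sub>t p }) (zip xs ys) 0"

text \<open>All \<open>k\<close>-tuples, with repetition, of entries of a list.\<close>

primrec tuples_t :: "nat \<Rightarrow> 'a list \<Rightarrow> 'a list list timed" where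
  "tuples_t 0 xs = return [[]]"
| "tuples_t (Suc k) xs = do {
     ts \<leftarrow> tuples_t k xs;
     tss \<leftarrow> map_t (\<lambda>x. map_t (\<lambda>t. return (x # t)) ts) xs;
     return (concat tss) }"


subsection \<open>Gaussian elimination\<close>

primrec find_pivot_t :: "rat list list \<Rightarrow> (rat list \<times> rat list list) option timed" where
  "find_pivot_t [] = return None"
| "find_pivot_t (r # rs) = do {
     zero \<leftarrow> hd r =\<^sub>t 0;
     if zero then do {
       res \<leftarrow> find_pivot_t rs;
       return (map_option (\<lambda>(p, qs). (p, r # qs)) res) }
     else return (Some (r, rs)) }"

text \<open>Clears the first entry of \<open>r\<close> using the pivot row \<open>p\<close> and drops it.\<close>

definition reduce_row_t :: "rat list \<Rightarrow> rat list \<Rightarrow> rat list timed" where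
  "reduce_row_t p r = do {
     q \<leftarrow> hd r /\<^sub>t hd p;
     map_t (\<lambda>(x, y). do { z \<leftarrow> q *\<^sub>t y; x -\<^sub>t z }) (zip (tl r) (tl p)) }"

text \<open>
  Forward elimination of the first \<open>k\<close> columns: the \<open>i\<close>-th pivot row, without its \<open>i\<close> leading
  zeros. The result is \<^const>\<open>None\<close> if some column has no pivot, i.e. if the first \<open>k\<close> columns
  are linearly dependent.
\<close>

primrec eliminate_t :: "nat \<Rightarrow> rat list list \<Rightarrow> rat list list option timed" where
  "eliminate_t 0 A = return (Some [])"
| "eliminate_t (Suc k) A = do {
     piv \<leftarrow> find_pivot_t A;
     case piv of
       None \<Rightarrow> return None
     | Some (p, rs) \<Rightarrow> do {
         rs' \<leftarrow> map_t (reduce_row_t p) rs;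
         e \<leftarrow> eliminate_t k rs';
         return (map_option ((#) p) e) } }"

text \<open>The last entry of each row is its right-hand side.\<close>

primrec back_substitute_t :: "rat list list \<Rightarrow> rat list timed" where
  "back_substitute_t [] = return []"
| "back_substitute_t (r # rs) = do {
     xs \<leftarrow> back_substitute_t rs;
     s \<leftarrow> dot_t (butlast (tl r)) xs;
     t \<leftarrow> last r -\<^sub>t s;
     x \<leftarrow> t /\<^sub>t hd r;
     return (x # xs) }"

text \<open>Solves a square system in \<open>k\<close> unknowns, given by its augmented matrix.\<close>

definition solve_t :: "nat \<Rightarrow> rat list list \<Rightarrow> rat list option timed" where
  "solve_t k A = do {
     e \<leftarrow> eliminate_t k A;
     case e of
       None \<Rightarrow> return None
     | Some rs \<Rightarrow> do { xs \<leftarrow> back_substitute_t rs; return (Some xs) } }"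

text \<open>
  Points \<open>c\<^sub>0, \<dots>, c\<^sub>n\<close> of \<open>n\<close>-space are affinely independent iff the \<open>n\<close> differences
  \<open>c\<^sub>i - c\<^sub>0\<close> are linearly independent, i.e. form a nonsingular square matrix.
\<close>

definition affinely_independent_t :: "nat \<Rightarrow> rat list list \<Rightarrow> bool timed" where
  "affinely_independent_t n cs = do {
     ds \<leftarrow> map_t (\<lambda>c. diff_t c (hd cs)) (tl cs);
     e \<leftarrow> eliminate_t n ds;
     return (e \<noteq> None) }"


section \<open>The algorithm\<close>

text \<open>The numbers \<open>k, k + 1, k + 2, \<dots>\<close> up to \<open>M\<close>.\<close>

function count_up_t :: "rat \<Rightarrow> rat \<Rightarrow> rat list timed" where
  "count_up_t k M = do {
     le \<leftarrow> k \<le>\<^sub>t M;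
     if le then do { k' \<leftarrow> k +\<^sub>t 1; ks \<leftarrow> count_up_t k' M; return (k # ks) }
     else return [] }"
  by auto

termination
proof (relation "Wellfounded.measure (\<lambda>(k, M). nat (\<lfloor>M\<rfloor> + 1 - \<lfloor>k\<rfloor>))", goal_cases)
  case 1
  show ?case by simp
next
  case (2 k M le k')
  then have "k \<le> M" and "k' = k + 1"
    by (simp_all add: le_t_def add_t_def tick_def)
  then have "\<lfloor>k\<rfloor> \<le> \<lfloor>M\<rfloor>" and "\<lfloor>k'\<rfloor> = \<lfloor>k\<rfloor> + 1"
    by (simp_all add: floor_mono)
  then show ?case by simp
qed

text \<open>
  With \<open>M = \<mu>\<^sub>0 \<beta>\<^sub>0\<close>, the set \<open>[0,1]\<^sup>n - \<mu>\<^sub>0 [-\<beta>\<^sub>0,\<beta>\<^sub>0]\<^sup>n\<close> of all differences is the cube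
  \<open>[-M, 1 + M]\<^sup>n\<close>. The integers in \<open>[-M, 1 + M]\<close> are the numbers \<open>-k\<close> and \<open>k + 1\<close> for the
  natural numbers \<open>k \<le> M\<close>.
\<close>

definition lattice_points_t :: "nat \<Rightarrow> rat \<Rightarrow> rat list list timed" where
  "lattice_points_t n M = do {
     ks \<leftarrow> count_up_t 0 M;
     us \<leftarrow> map_t (\<lambda>k. 0 -\<^sub>t k) ks;
     vs \<leftarrow> map_t (\<lambda>k. k +\<^sub>t 1) ks;
     tuples_t n (us @ vs) }"

text \<open>
  Membership of \<open>y\<close> in the interior of \<open>\<mu>P\<close>: this set is empty for \<open>\<mu> = 0\<close> (as \<open>n \<ge> 1\<close>), and
  otherwise \<open>y\<close> belongs to it iff \<open>y/\<mu>\<close> strictly satisfies all facet inequalities of \<open>P\<close>.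
\<close>

definition in_interior_t :: "rat facet list \<Rightarrow> rat \<Rightarrow> rat list \<Rightarrow> bool timed" where
  "in_interior_t F \<mu> y = do {
     zero \<leftarrow> \<mu> =\<^sub>t 0;
     if zero then return False
     else do {
       x \<leftarrow> map_t (\<lambda>c. c /\<^sub>t \<mu>) y;
       all_t (\<lambda>(a, b). do { s \<leftarrow> dot_t a x; s <\<^sub>t b }) F } }"

definition uncovered_t :: "rat facet list \<Rightarrow> rat list list \<Rightarrow> rat \<Rightarrow> rat list \<Rightarrow> bool timed" where
  "uncovered_t F L \<mu> p =
     all_t (\<lambda>z. do { y \<leftarrow> diff_t p z; inside \<leftarrow> in_interior_t F \<mu> y; return (\<not> inside) }) L"

definition in_unit_cube_t :: "rat list \<Rightarrow> bool timed" where
  "in_unit_cube_t p =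
     all_t (\<lambda>c. do { l \<leftarrow> 0 \<le>\<^sub>t c; u \<leftarrow> c \<le>\<^sub>t 1; return (l \<and> u) }) p"

text \<open>
  The body of the loop over the tuples \<open>zs\<close> of lattice points and \<open>fs\<close> of facets. The equation
  \<open>\<mu> = a\<^sup>T (x - z) / b\<close> is the row \<open>-\<mu> + c\<^sup>T x = c\<^sup>T z\<close>, where \<open>c = a/b\<close>, in the unknowns \<open>(\<mu>, x)\<close>.
\<close>

definition candidate_step_t ::
  "nat \<Rightarrow> rat facet list \<Rightarrow> rat list list \<Rightarrow> rat list list \<Rightarrow> rat facet list \<Rightarrow> rat \<Rightarrow> rat timed"
where
  "candidate_step_t n F L zs fs \<mu>max = do {
     cs \<leftarrow> map_t (\<lambda>(a, b). map_t (\<lambda>c. c /\<^sub>t b) a) fs;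
     indep \<leftarrow> affinely_independent_t n cs;
     if indep then do {
       A \<leftarrow> map_t (\<lambda>(c, z). do { s \<leftarrow> dot_t c z; return (- 1 # c @ [s]) }) (zip cs zs);
       sol \<leftarrow> solve_t (n + 1) A;
       case sol of
         Some (\<mu> # p) \<Rightarrow> do {
           cube \<leftarrow> in_unit_cube_t p;
           if cube then do {
             unc \<leftarrow> uncovered_t F L \<mu> p;
             if unc then max_t \<mu> \<mu>max else return \<mu>max }
           else return \<mu>max }
       | _ \<Rightarrow> return \<mu>max }
     else return \<mu>max }"

definition CoveringRadius_param :: "nat \<Rightarrow> rat facet list \<Rightarrow> rat \<Rightarrow> rat \<Rightarrow> rat timed" where
  "CoveringRadius_param n F \<beta>0 \<mu>0 = do {
     M \<leftarrow> \<mu>0 *\<^sub>t \<beta>0;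
     L \<leftarrow> lattice_points_t n M;
     zss \<leftarrow> tuples_t (n + 1) L;
     fss \<leftarrow> tuples_t (n + 1) F;
     fold_t (\<lambda>zs. fold_t (\<lambda>fs. candidate_step_t n F L zs fs) fss) zss 0 }"

definition facet_norm_t :: "rat facet list \<Rightarrow> rat timed" where
  "facet_norm_t F =
     fold_t (\<lambda>(a, b) s. do {
       s' \<leftarrow> fold_t (\<lambda>c t. do { d \<leftarrow> abs_t c; max_t d t }) a s;
       max_t b s' }) F 0"

definition rational_facets :: "int facet list \<Rightarrow> rat facet list" where
  "rational_facets F = map (\<lambda>(a, b). (map of_int a, of_int b)) F"

definition CoveringRadius :: "nat \<Rightarrow> int facet list \<Rightarrow> rat timed" where
  "CoveringRadius n F = do {
     N \<leftarrow> facet_norm_t (rational_facets F);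
     q \<leftarrow> power_t N n;
     f \<leftarrow> fact_t n;
     \<beta>0 \<leftarrow> q *\<^sub>t f;
     \<mu>0 \<leftarrow> of_nat n *\<^sub>t \<beta>0;
     CoveringRadius_param n (rational_facets F) \<beta>0 \<mu>0 }"

end

(*
  The covering radius mu is the largest level of the function x |-> min_z max_i a_i^T(x - z)/b_i,
  where z ranges over the integer points; this level is attained in the unit cube. Among the points p
  of level mu that are covered by mu P itself, take one of maximal Euclidean norm. If a hyperplane
  a^T d = t contained all the normals a_i/b_i active at p, then moving p in direction d or -d would
  either raise the level (t <> 0) or show that p +- s d are such points for small s (t = 0), against
  maximality. So n + 1 active pairs (z, a_i) have affinely independent a_i/b_i, and (mu, p) is one
  of the candidates that the algorithm inspects. Conversely, at a level above mu every point of the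
  cube lies in the interior of some translate in the list, so no larger candidate is accepted.

  The vertices of P have coordinates at most beta_0 by Cramer's rule, and P contains a cube of side
  2/(n ||P||), which bounds mu by mu_0; hence the finite list of integer points suffices. For the
  elimination, only two facts matter: independent columns never run out of pivots, and every step
  preserves a given (real) solution, which makes mu and p rational as a by-product.
*)

theory Submission
  imports Defs "Jordan_Normal_Form.Determinant"
begin

section \<open>Linear functionals and lattice points\<close>

text \<open>The critical level is produced by compactness and is a priori only a real number,
  whereas the algorithm computes with rationals and sees finitely many translates. Three choices of
  form bridge the gap. Facets enter the geometry as functionals c = a/b, so that membership of y in
  \<mu>P reads c^T y \<le> \<mu> for all c: this is linear in the pair (\<mu>, y), makes sense at
  \<mu> = 0, and matches the rows that the algorithm sets up. Independence is always stated as
  triviality of a common kernel over the reals, the one form that the perturbation argument,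
  Cramer's rule and the elimination of rational matrices can all use. Being in the interior of no
  translate is stated as a family of weak inequalities, hence as a closed condition that survives
  lattice translations. The resulting set of points is in general not convex, which is why
  extremality is used in the symmetric form "x + d and x - d in K imply d = 0".\<close>

definition dotp :: "nat \<Rightarrow> (nat \<Rightarrow> real) \<Rightarrow> (nat \<Rightarrow> real) \<Rightarrow> real" where
  "dotp n c x = (\<Sum>j<n. c j * x j)"

lemma dotp_diff: "dotp n c (x - y) = dotp n c x - dotp n c y"
  by (simp add: dotp_def sum_subtractf right_diff_distrib)

lemma dotp_scale: "dotp n c (\<lambda>j. s * x j) = s * dotp n c x"
  by (simp add: dotp_def sum_distrib_left mult_ac)

lemma dotp_line: "dotp n c (\<lambda>j. x j + s * d j) = dotp n c x + s * dotp n c d"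
  by (simp add: dotp_def sum.distrib sum_distrib_left algebra_simps)

lemma dotp_uminus: "dotp n c (- x) = - dotp n c x"
  by (simp add: dotp_def sum_negf)

lemma dotp_zero [simp]: "dotp n c 0 = 0"
  by (simp add: dotp_def)

lemma continuous_on_coordinate: "continuous_on S (\<lambda>x :: nat \<Rightarrow> real. x j)"
  by (rule continuous_on_subset[OF continuous_on_product_coordinates subset_UNIV])

lemma continuous_on_dotp: "continuous_on S (dotp n c)"
  unfolding dotp_def by (intro continuous_intros continuous_on_coordinate)

lemma real_space_iff: "x \<in> real_space n \<longleftrightarrow> (\<forall>j\<ge>n. x j = 0)"
  by (simp add: topspace_Euclidean_space)

lemma real_space_diff: "x \<in> real_space n \<Longrightarrow> y \<in> real_space n \<Longrightarrow> x - y \<in> real_space n"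
  and real_space_add: "x \<in> real_space n \<Longrightarrow> y \<in> real_space n \<Longrightarrow> x + y \<in> real_space n"
  and real_space_zero: "0 \<in> real_space n"
  and real_space_scale: "x \<in> real_space n \<Longrightarrow> (\<lambda>j. s * x j) \<in> real_space n"
  and real_space_uminus: "x \<in> real_space n \<Longrightarrow> - x \<in> real_space n"
  by (simp_all add: real_space_iff)

lemma integer_lattice_real_space: "z \<in> integer_lattice n \<Longrightarrow> z \<in> real_space n"
  by (simp add: integer_lattice_def)

lemma integer_lattice_diff:
  "y \<in> integer_lattice n \<Longrightarrow> z \<in> integer_lattice n \<Longrightarrow> y - z \<in> integer_lattice n"
  and integer_lattice_add:
  "y \<in> integer_lattice n \<Longrightarrow> z \<in> integer_lattice n \<Longrightarrow> y + z \<in> integer_lattice n"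
  and integer_lattice_zero: "0 \<in> integer_lattice n"
  by (auto simp: integer_lattice_def real_space_iff)

lemma real_space_eqI: "x \<in> real_space n \<Longrightarrow> y \<in> real_space n \<Longrightarrow> (\<And>j. j < n \<Longrightarrow> x j = y j) \<Longrightarrow> x = y"
  unfolding real_space_iff by (metis ext not_le)

section \<open>Topology of boxes: compactness and finitely many lattice points\<close>

lemma closed_real_space: "closed (real_space n)"
proof -
  have "closed (\<Inter>j\<in>{n..}. {x :: nat \<Rightarrow> real. x j = 0})"
    by (intro closed_INT ballI closed_Collect_eq continuous_on_coordinate continuous_on_const)
  moreover have "(\<Inter>j\<in>{n..}. {x. x j = 0}) = real_space n"
    by (auto simp: real_space_iff)
  ultimately show ?thesis by simp
qed

text \<open>Tychonoff: a product over all indices, with the factor {0} from index \<open>n\<close>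
  on. All later compactness comes from closed subsets of such boxes.\<close>

lemma compact_real_box: "compact {x \<in> real_space n. \<forall>j<n. l \<le> x j \<and> x j \<le> u}"
proof -
  have "compactin (product_topology (\<lambda>_. euclidean) UNIV)
    (PiE UNIV (\<lambda>j. if j < n then {l..u} else {0 :: real}))"
    by (subst compactin_PiE) auto
  moreover have "PiE UNIV (\<lambda>j. if j < n then {l..u} else {0}) =
      {x \<in> real_space n. \<forall>j<n. l \<le> x j \<and> x j \<le> u}"
    by (fastforce simp: PiE_def real_space_iff not_less split: if_splits)
  ultimately show ?thesis by (simp add: euclidean_product_topology)
qed

lemma finite_lattice_box: "finite {z \<in> integer_lattice n. \<forall>j<n. l \<le> z j \<and> z j \<le> u}"
proof -
  have "finite {k :: int. l \<le> k \<and> k \<le> u}"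
    by (rule finite_subset[of _ "{\<lceil>l\<rceil>..\<lfloor>u\<rfloor>}"]) (auto simp: ceiling_le_iff le_floor_iff)
  then have "finite {f. \<forall>j. (j \<in> {..<n} \<longrightarrow> f j \<in> real_of_int ` {k. l \<le> k \<and> k \<le> u}) \<and>
      (j \<notin> {..<n} \<longrightarrow> f j = 0)}"
    by (intro finite_set_of_finite_funs) auto
  then show ?thesis
  proof (rule rev_finite_subset, intro subsetI CollectI allI conjI impI)
    fix z j assume z: "z \<in> {z \<in> integer_lattice n. \<forall>j<n. l \<le> z j \<and> z j \<le> u}"
    show "z j = 0" if "j \<notin> {..<n}"
      using z that by (simp add: integer_lattice_def real_space_iff)
    assume "j \<in> {..<n}"
    with z have "z j \<in> \<int>" "l \<le> z j" "z j \<le> u" by (auto simp: integer_lattice_def)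
    then show "z j \<in> real_of_int ` {k. l \<le> k \<and> k \<le> u}" by (auto elim!: Ints_cases)
  qed
qed

text \<open>Maximise the strictly convex function \<open>|x|\<^sup>2\<close>; \<open>K\<close> itself need not be convex.\<close>

lemma exists_extreme_point:
  assumes "compact K" "K \<noteq> {}" "K \<subseteq> real_space n"
  obtains x where "x \<in> K"
    "\<And>d. d \<in> real_space n \<Longrightarrow> x + d \<in> K \<Longrightarrow> x - d \<in> K \<Longrightarrow> d = 0"
proof -
  have "continuous_on K (\<lambda>x. \<Sum>j<n. (x j)\<^sup>2)"
    by (intro continuous_intros continuous_on_coordinate)
  then obtain x where x: "x \<in> K" "\<And>y. y \<in> K \<Longrightarrow> (\<Sum>j<n. (y j)\<^sup>2) \<le> (\<Sum>j<n. (x j)\<^sup>2)"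
    using continuous_attains_sup[OF assms(1,2)] by blast
  show thesis
  proof (rule that[OF x(1)])
    fix d assume d: "d \<in> real_space n" "x + d \<in> K" "x - d \<in> K"
    have "(\<Sum>j<n. ((x + d) j)\<^sup>2) + (\<Sum>j<n. ((x - d) j)\<^sup>2) = 2 * (\<Sum>j<n. (x j)\<^sup>2) + 2 * (\<Sum>j<n. (d j)\<^sup>2)"
      by (simp add: sum.distrib[symmetric] sum_distrib_left power2_eq_square algebra_simps)
    with x(2)[OF d(2)] x(2)[OF d(3)] have "(\<Sum>j<n. (d j)\<^sup>2) \<le> 0" by linarith
    then have "(\<Sum>j<n. (d j)\<^sup>2) = 0" by (simp add: sum_nonneg order_antisym)
    then have "d j = 0" if "j < n" for j
      using that by (subst (asm) sum_nonneg_eq_0_iff) auto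
    with d(1) show "d = 0" by (intro real_space_eqI[of _ n]) (auto simp: real_space_zero)
  qed
qed

text \<open>Elimination of the last column, by induction on \<open>k\<close>: a row \<open>b\<close>
  with nonzero last entry exists, since otherwise the last unit vector would lie in the kernel, and
  subtracting its multiples clears that column in all rows. \<open>A\<close> may be infinite, as
  only \<open>k\<close> pivot rows are picked.\<close>

lemma exists_independent_rows:
  fixes r :: "'a \<Rightarrow> nat \<Rightarrow> real"
  assumes "\<And>v. (\<forall>a\<in>A. (\<Sum>j<k. r a j * v j) = 0) \<Longrightarrow> \<forall>j<k. v j = 0"
  shows "\<exists>as. length as = k \<and> set as \<subseteq> A \<and>
    (\<forall>v. (\<forall>a\<in>set as. (\<Sum>j<k. r a j * v j) = 0) \<longrightarrow> (\<forall>j<k. v j = 0))"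
  using assms
proof (induction k arbitrary: r)
  case 0
  show ?case by (rule exI[of _ "[]"]) simp
next
  case (Suc k)
  obtain b where b: "b \<in> A" "r b k \<noteq> 0"
  proof (rule ccontr)
    assume "\<not> thesis"
    then have "\<forall>a\<in>A. r a k = 0" using that by blast
    then have "\<forall>a\<in>A. (\<Sum>j<Suc k. r a j * (if j = k then 1 else 0)) = 0" by simp
    from Suc.prems[OF this] show False by auto
  qed
  define r' where "r' a j = r a j - r a k / r b k * r b j" for a j
  \<comment> \<open>\<open>ext v\<close> appends to \<open>v\<close> the unique last entry that
    makes row \<open>b\<close> vanish, so kernel vectors of the reduced rows lift to kernel vectors
    of the original ones.\<close>
  define ext where "ext v j = (if j < k then v j else - (\<Sum>j<k. r b j * v j) / r b k)" for v j
  have ext_b: "(\<Sum>j<Suc k. r b j * ext v j) = 0" for v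
    using b by (simp add: ext_def)
  have lift: "(\<Sum>j<k. r' a j * v j) = (\<Sum>j<k. r a j * v j) - r a k / r b k * (\<Sum>j<k. r b j * v j)" for a v
    by (simp add: r'_def sum_subtractf left_diff_distrib sum_distrib_left mult.assoc)
  have IH: "\<forall>j<k. v j = 0" if v: "\<forall>a\<in>A. (\<Sum>j<k. r' a j * v j) = 0" for v
  proof -
    have "(\<Sum>j<Suc k. r a j * ext v j) = (\<Sum>j<k. r' a j * v j)" for a
      unfolding lift by (simp add: ext_def)
    with v have "\<forall>a\<in>A. (\<Sum>j<Suc k. r a j * ext v j) = 0" by simp
    from Suc.prems[OF this] have "\<forall>j<k. ext v j = 0" by auto
    then show ?thesis by (simp add: ext_def)
  qed
  obtain as where as: "length as = k" "set as \<subseteq> A"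
    and ker: "\<And>v. (\<forall>a\<in>set as. (\<Sum>j<k. r' a j * v j) = 0) \<Longrightarrow> (\<forall>j<k. v j = 0)"
    using Suc.IH[where r = r', OF IH] by metis
  show ?case
  proof (intro exI[of _ "b # as"] conjI allI impI)
    fix v j assume v: "\<forall>a\<in>set (b # as). (\<Sum>j<Suc k. r a j * v j) = 0" and j: "j < Suc k"
    have rb: "(\<Sum>j<k. r b j * v j) = - r b k * v k" using v by simp
    have "\<forall>a\<in>set as. (\<Sum>j<k. r' a j * v j) = 0"
      using v b(2) unfolding lift rb by auto
    from ker[OF this] have *: "\<forall>j<k. v j = 0" .
    with rb b(2) have "v k = 0" by simp
    with * j show "v j = 0" by (auto simp: less_Suc_eq)
  qed (use as b in auto)
qed

text \<open>
  For functionals \<open>c\<^sub>i\<close>, this is the statement that the rows \<open>(-1, c\<^sub>i)\<close> have trivial common kernel,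
  i.e. that the points \<open>c\<^sub>i\<close> affinely span the space.
\<close>

definition affinely_spanning :: "nat \<Rightarrow> (nat \<Rightarrow> real) set \<Rightarrow> bool" where
  "affinely_spanning n S \<longleftrightarrow>
    (\<forall>d\<in>real_space n. \<forall>t. (\<forall>c\<in>S. dotp n c d = t) \<longrightarrow> t = 0 \<and> d = 0)"

text \<open>Homogenisation: appending the entry -1 at index \<open>n\<close> turns affine span into
  linear span, and a kernel vector carries the common value \<open>t\<close> in that extra
  coordinate.\<close>

lemma exists_affinely_independent:
  fixes c :: "'a \<Rightarrow> nat \<Rightarrow> real"
  assumes span: "affinely_spanning n (c ` A)"
  shows "\<exists>as. length as = Suc n \<and> set as \<subseteq> A \<and> affinely_spanning n (c ` set as)"
proof -
  define r where "r a j = (if j < n then c a j else - 1)" for a j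
  have row: "(\<Sum>j<Suc n. r a j * v j) = dotp n (c a) v - v n" for a v
    by (simp add: r_def dotp_def)
  have *: "\<forall>j<Suc n. v j = 0" if v: "\<forall>a\<in>A. (\<Sum>j<Suc n. r a j * v j) = 0" for v
  proof -
    let ?d = "\<lambda>j. if j < n then v j else 0"
    have "dotp n (c a) ?d = dotp n (c a) v" for a by (simp add: dotp_def)
    then have "\<forall>a\<in>A. dotp n (c a) ?d = v n" using v unfolding row by simp
    moreover have "?d \<in> real_space n" by (simp add: real_space_iff)
    ultimately have "v n = 0 \<and> ?d = 0" using span unfolding affinely_spanning_def by blast
    then show ?thesis by (auto simp: fun_eq_iff less_Suc_eq split: if_splits)
  qed
  obtain as where as: "length as = Suc n" "set as \<subseteq> A"
    "\<And>v. (\<forall>a\<in>set as. (\<Sum>j<Suc n. r a j * v j) = 0) \<Longrightarrow> (\<forall>j<Suc n. v j = 0)"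
    using exists_independent_rows[where A = A and k = "Suc n" and r = r, OF *] by metis
  have "t = 0 \<and> d = 0" if d: "d \<in> real_space n" "\<forall>c\<in>c ` set as. dotp n c d = t" for t d
  proof -
    let ?v = "\<lambda>j. if j < n then d j else t"
    have "dotp n (c a) ?v = dotp n (c a) d" for a by (simp add: dotp_def)
    then have "\<forall>a\<in>set as. (\<Sum>j<Suc n. r a j * ?v j) = 0" using d unfolding row by simp
    from as(3)[OF this] have "\<forall>j<Suc n. ?v j = 0" .
    then have "t = 0" "\<And>j. j < n \<Longrightarrow> d j = 0" by (auto dest: spec[of _ n] simp: less_Suc_eq)
    with d(1) show ?thesis by (auto intro: real_space_eqI[of _ n] simp: real_space_zero)
  qed
  with as show ?thesis unfolding affinely_spanning_def by blast
qed

text \<open>Keeps of the polytope only the functionals c = a/b and a coordinate bound; the explicit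
  bound \<open>b0\<close> is supplied later by the vertices.\<close>

locale gauge =
  fixes n :: nat and C :: "(nat \<Rightarrow> real) set" and \<beta> :: real
  assumes n_pos: "0 < n" and finite_C: "finite C"
    and body_bounded: "\<And>x j. x \<in> real_space n \<Longrightarrow> (\<And>c. c \<in> C \<Longrightarrow> dotp n c x \<le> 1) \<Longrightarrow> j < n \<Longrightarrow> \<bar>x j\<bar> \<le> \<beta>"
begin

lemma scaled_body_bounded:
  assumes "x \<in> real_space n" "\<And>c. c \<in> C \<Longrightarrow> dotp n c x \<le> \<mu>" "0 < \<mu>" "j < n"
  shows "\<bar>x j\<bar> \<le> \<mu> * \<beta>"
proof -
  have "\<bar>(1 / \<mu>) * x j\<bar> \<le> \<beta>"
    using body_bounded[of "\<lambda>j. 1 / \<mu> * x j" j] assms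
    by (simp only: dotp_scale real_space_scale) (simp add: field_simps)
  with assms(3) show ?thesis by (simp add: abs_mult field_simps)
qed

text \<open>A bounded body contains no ray: \<open>d\<close> lies in every positive dilate, so its
  coordinates are at most \<open>e * \<beta>\<close> for every \<open>e > 0\<close>.\<close>

lemma recession_trivial:
  assumes "d \<in> real_space n" "\<And>c. c \<in> C \<Longrightarrow> dotp n c d \<le> 0"
  shows "d = 0"
proof -
  have "d j = 0" if "j < n" for j
  proof (rule ccontr)
    assume "d j \<noteq> 0"
    have bd: "\<bar>d j\<bar> \<le> e * \<beta>" if "0 < e" for e
      using scaled_body_bounded[OF assms(1) _ that \<open>j < n\<close>] assms(2) that
      by (meson less_eq_real_def order_trans)
    with \<open>d j \<noteq> 0\<close> have "\<beta> > 0" using bd[of 1] by simp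
    \<comment> \<open>This choice of \<open>e\<close> yields |d j| \<le> |d j| / 2.\<close>
    with bd[of "\<bar>d j\<bar> / (2 * \<beta>)"] \<open>d j \<noteq> 0\<close> show False by simp
  qed
  with assms(1) show ?thesis by (intro real_space_eqI[of _ n]) (auto simp: real_space_zero)
qed

lemma C_nonempty: "C \<noteq> {}"
proof
  assume "C = {}"
  let ?e = "\<lambda>j :: nat. if j = 0 then 1 else 0 :: real"
  have "?e \<in> real_space n" using n_pos by (simp add: real_space_iff)
  then have "?e = 0" by (rule recession_trivial) (simp add: \<open>C = {}\<close>)
  from fun_cong[OF this, of 0] show False by simp
qed

text \<open>If all functionals were negative at \<open>x\<close>, then \<open>x\<close> would be a
  recession direction, hence 0, where they vanish. This rules out covering at negative levels
  (\<open>covers_nonneg\<close>).\<close>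

lemma gauge_nonneg:
  assumes "x \<in> real_space n"
  shows "\<exists>c\<in>C. 0 \<le> dotp n c x"
proof (rule ccontr)
  assume "\<not> ?thesis"
  then have *: "\<And>c. c \<in> C \<Longrightarrow> dotp n c x < 0" by force
  then have "x = 0" using assms by (intro recession_trivial) (auto intro: less_imp_le)
  with * C_nonempty show False by auto
qed

end

section \<open>Points covered last\<close>

lemma continuous_on_Min:
  fixes f :: "'a \<Rightarrow> 'b::topological_space \<Rightarrow> real"
  assumes "finite I" "I \<noteq> {}" "\<And>i. i \<in> I \<Longrightarrow> continuous_on S (f i)"
  shows "continuous_on S (\<lambda>x. Min ((\<lambda>i. f i x) ` I))"
  using assms
proof (induction I rule: finite_ne_induct)
  case (insert i I)
  then show ?case by (simp add: continuous_on_min)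
qed simp

lemma continuous_on_Max:
  fixes f :: "'a \<Rightarrow> 'b::topological_space \<Rightarrow> real"
  assumes "finite I" "I \<noteq> {}" "\<And>i. i \<in> I \<Longrightarrow> continuous_on S (f i)"
  shows "continuous_on S (\<lambda>x. Max ((\<lambda>i. f i x) ` I))"
  using assms
proof (induction I rule: finite_ne_induct)
  case (insert i I)
  then show ?case by (simp add: continuous_on_max)
qed simp

definition lattice_floor :: "nat \<Rightarrow> (nat \<Rightarrow> real) \<Rightarrow> nat \<Rightarrow> real" where
  "lattice_floor n x = (\<lambda>j. if j < n then of_int \<lfloor>x j\<rfloor> else 0)"

lemma lattice_floor_in: "lattice_floor n x \<in> integer_lattice n"
  by (simp add: lattice_floor_def integer_lattice_def real_space_iff)

definition unit_cube :: "nat \<Rightarrow> (nat \<Rightarrow> real) set" where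
  "unit_cube n = {x \<in> real_space n. \<forall>j<n. 0 \<le> x j \<and> x j \<le> 1}"

lemma fractional_part_in_unit_cube:
  "x \<in> real_space n \<Longrightarrow> x - lattice_floor n x \<in> unit_cube n"
  by (auto simp: lattice_floor_def unit_cube_def real_space_iff floor_le_iff) linarith

context gauge
begin

text \<open>For \<open>y\<close> in \<open>real_space n\<close> this is membership in \<mu>P,
  written without division by \<mu>; at \<mu> = 0 it leaves only y = 0, in agreement with the dilate
  (\<open>dilate_polyhedron\<close>).\<close>

definition covers :: "real \<Rightarrow> (nat \<Rightarrow> real) \<Rightarrow> bool" where
  "covers \<mu> y \<longleftrightarrow> (\<forall>c\<in>C. dotp n c y \<le> \<mu>)"

lemma covers_mono: "covers \<mu> y \<Longrightarrow> \<mu> \<le> \<nu> \<Longrightarrow> covers \<nu> y"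
  by (force simp: covers_def)

lemma covers_bounded:
  "covers \<mu> y \<Longrightarrow> y \<in> real_space n \<Longrightarrow> 0 < \<mu> \<Longrightarrow> j < n \<Longrightarrow> \<bar>y j\<bar> \<le> \<mu> * \<beta>"
  unfolding covers_def by (rule scaled_body_bounded) auto

lemma covers_nonneg: "covers \<mu> y \<Longrightarrow> y \<in> real_space n \<Longrightarrow> 0 \<le> \<mu>"
  using gauge_nonneg[of y] by (force simp: covers_def)

definition lattice_covers :: "real \<Rightarrow> bool" where
  "lattice_covers \<mu> \<longleftrightarrow> (\<forall>x\<in>real_space n. \<exists>z\<in>integer_lattice n. covers \<mu> (x - z))"

text \<open>Lower-bound certificate: no level below \<mu> covers \<open>p\<close>, and for \<mu> > 0
  the point \<open>p\<close> lies in the interior of no translate of \<mu>P.\<close>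

definition last_covered :: "real \<Rightarrow> (nat \<Rightarrow> real) \<Rightarrow> bool" where
  "last_covered \<mu> p \<longleftrightarrow> p \<in> real_space n \<and> (\<forall>z\<in>integer_lattice n. \<exists>c\<in>C. \<mu> \<le> dotp n c (p - z))"

lemma last_covered_translate:
  assumes "last_covered \<mu> p" "z \<in> integer_lattice n"
  shows "last_covered \<mu> (p - z)"
proof -
  have "\<exists>c\<in>C. \<mu> \<le> dotp n c (p - z - y)" if "y \<in> integer_lattice n" for y
  proof -
    have "z + y \<in> integer_lattice n" using assms(2) that by (rule integer_lattice_add)
    with assms(1) show ?thesis unfolding last_covered_def by (metis diff_diff_add)
  qed
  moreover have "p - z \<in> real_space n"
    using assms integer_lattice_real_space unfolding last_covered_def by (metis real_space_diff)
  ultimately show ?thesis by (simp add: last_covered_def)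
qed

text \<open>The minimum over the whole lattice is replaced by a minimum over a finite window
  \<open>L\<close>, which makes the level continuous; lattice points outside \<open>L\<close> are
  then shown to be too far away to lower it at the maximiser.\<close>

lemma exists_last_covered:
  assumes "0 < \<mu>0" "\<And>x. x \<in> unit_cube n \<Longrightarrow> covers \<mu>0 x"
  obtains \<mu> p where "0 \<le> \<mu>" "\<mu> \<le> \<mu>0" "lattice_covers \<mu>" "last_covered \<mu> p"
proof -
  \<comment> \<open>If x is in the unit cube and x - z in the dilate by \<open>\<mu>0\<close>, then
    |x j - z j| \<le> \<open>\<mu>0 * \<beta>\<close>, which puts z into this window.\<close>
  define L where "L = {z \<in> integer_lattice n. \<forall>j<n. - (\<mu>0 * \<beta>) \<le> z j \<and> z j \<le> \<mu>0 * \<beta> + 1}"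
  define g where "g y = Max ((\<lambda>c. dotp n c y) ` C)" for y
  have g_le: "g y \<le> \<mu> \<longleftrightarrow> covers \<mu> y" for y \<mu>
    unfolding g_def covers_def using finite_C C_nonempty by (subst Max_le_iff) auto
  have cube_ne: "0 \<in> unit_cube n" by (simp add: unit_cube_def real_space_zero)
  have beta: "0 \<le> \<mu>0 * \<beta>"
    using covers_bounded[OF assms(2)[OF cube_ne] real_space_zero assms(1) n_pos] by simp
  have fin: "finite L" unfolding L_def by (rule finite_lattice_box)
  have zero: "0 \<in> L" using beta by (simp add: L_def integer_lattice_zero)
  have L_lat: "z \<in> integer_lattice n" if "z \<in> L" for z using that by (simp add: L_def)
  define h where "h x = Min ((\<lambda>z. g (x - z)) ` L)" for x
  have cont: "continuous_on (unit_cube n) (\<lambda>x. g (x - z))" for z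
    unfolding g_def dotp_diff
    by (intro continuous_on_Max finite_C C_nonempty continuous_intros continuous_on_dotp)
  have "compact (unit_cube n)" unfolding unit_cube_def by (rule compact_real_box)
  moreover have "continuous_on (unit_cube n) h"
    unfolding h_def by (rule continuous_on_Min[OF fin]) (use zero cont in auto)
  ultimately obtain p where p: "p \<in> unit_cube n" "\<And>x. x \<in> unit_cube n \<Longrightarrow> h x \<le> h p"
    using continuous_attains_sup[of "unit_cube n" h] cube_ne by blast
  have p_real: "p \<in> real_space n" using p(1) by (simp add: unit_cube_def)
  have h_le: "h x \<le> \<mu> \<longleftrightarrow> (\<exists>z\<in>L. covers \<mu> (x - z))" for x \<mu>
    unfolding h_def using fin zero by (subst Min_le_iff) (auto simp: g_le)
  have le: "h p \<le> \<mu>0"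
    unfolding h_le using zero assms(2)[OF p(1)] by (intro bexI[of _ 0]) simp_all
  obtain z where "z \<in> L" "covers (h p) (p - z)" using h_le[of p "h p"] by auto
  then have nonneg: "0 \<le> h p"
    using covers_nonneg real_space_diff[OF p_real] L_lat integer_lattice_real_space by blast
  have cov: "lattice_covers (h p)"
    unfolding lattice_covers_def
  proof
    fix x assume x: "x \<in> real_space n"
    obtain z where z: "z \<in> L" "covers (h p) (x - lattice_floor n x - z)"
      using p(2)[OF fractional_part_in_unit_cube[OF x]] h_le by blast
    then show "\<exists>z\<in>integer_lattice n. covers (h p) (x - z)"
      using integer_lattice_add[OF lattice_floor_in L_lat[OF z(1)]]
      by (intro bexI[of _ "lattice_floor n x + z"]) (simp_all add: diff_diff_add)
  qed
  have "last_covered (h p) p"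
    unfolding last_covered_def
  proof (intro conjI p_real ballI, rule ccontr)
    \<comment> \<open>A violating \<open>z\<close> would cover \<open>p\<close> below the level
      \<open>h p\<close> \<le> \<open>\<mu>0\<close>, hence lie in the window, where the minimum
      \<open>h p\<close> forbids it.\<close>
    fix z assume z: "z \<in> integer_lattice n" and neg: "\<not> (\<exists>c\<in>C. h p \<le> dotp n c (p - z))"
    have "covers \<mu>0 (p - z)" using neg le by (force simp: covers_def)
    then have bd: "\<bar>p j - z j\<bar> \<le> \<mu>0 * \<beta>" if "j < n" for j
      using covers_bounded[of \<mu>0 "p - z" j] that assms(1) real_space_diff[OF p_real integer_lattice_real_space[OF z]]
      by simp
    have "z \<in> L"
      unfolding L_def
    proof (intro CollectI conjI z allI impI)
      fix j assume "j < n"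
      with bd[OF this] p(1) show "- (\<mu>0 * \<beta>) \<le> z j" "z j \<le> \<mu>0 * \<beta> + 1"
        by (auto simp: unit_cube_def abs_le_iff dest!: spec[of _ j])
    qed
    have "g (p - z) < h p"
      unfolding g_def using finite_C C_nonempty neg by (subst Max_less_iff) force+
    moreover have "h p \<le> g (p - z)" using \<open>z \<in> L\<close> h_le[of p "g (p - z)"] g_le by blast
    ultimately show False by simp
  qed
  with nonneg le cov show thesis by (rule that)
qed

text \<open>The lattice point is kept along with the functional, since a row of the algorithm's
  system needs both. The condition \<open>covers\<close> discards hyperplanes that pass through
  \<open>p\<close> outside their translate, and keeps \<open>z\<close> within the window.\<close>

definition active :: "real \<Rightarrow> (nat \<Rightarrow> real) \<Rightarrow> ((nat \<Rightarrow> real) \<times> (nat \<Rightarrow> real)) set" where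
  "active \<mu> p = {(z, c). z \<in> integer_lattice n \<and> c \<in> C \<and> dotp n c (p - z) = \<mu> \<and> covers \<mu> (p - z)}"

text \<open>First-order argument in direction \<open>d\<close>. A translate containing
  \<open>p\<close> has a tight facet, which is active and grows at rate exactly \<open>t\<close>;
  any other translate has a facet strictly violated at \<open>p\<close>, which stays violated for
  small \<open>s\<close>. Used with \<open>t > 0\<close> to raise the level and with
  \<open>t = 0\<close> to stay on it.\<close>

lemma eventually_last_covered:
  assumes p: "last_covered \<mu> p" and d: "d \<in> real_space n" and \<mu>: "0 \<le> \<mu>" and t: "0 \<le> t"
    and act: "\<And>z c. (z, c) \<in> active \<mu> p \<Longrightarrow> dotp n c d = t"
  shows "\<forall>\<^sub>F s in at_right 0. \<forall>z\<in>integer_lattice n.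
    \<exists>c\<in>C. \<mu> + s * t \<le> dotp n c (\<lambda>j. p j + s * d j - z j)"
proof -
  define \<nu> where "\<nu> = \<mu> + t + 1"
  have \<nu>: "0 < \<nu>" using \<mu> t by (simp add: \<nu>_def)
  have p_real: "p \<in> real_space n" using p by (simp add: last_covered_def)
  \<comment> \<open>Large enough for every lattice point whose translate at level
    \<open>\<nu>\<close> meets the segment from p to p + d.\<close>
  define B where "B = \<nu> * \<beta> + (\<Sum>j<n. \<bar>p j\<bar>) + (\<Sum>j<n. \<bar>d j\<bar>)"
  define Z where "Z = {z \<in> integer_lattice n. \<forall>j<n. - B \<le> z j \<and> z j \<le> B}"
  have line: "dotp n c (\<lambda>j. p j + s * d j - z j) = dotp n c (p - z) + s * dotp n c d" for c s z
    using dotp_line[of n c "p - z" s d] by (simp add: algebra_simps)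
  have "finite Z" unfolding Z_def by (rule finite_lattice_box)
  moreover have "\<forall>z\<in>Z. \<forall>\<^sub>F s in at_right 0. \<exists>c\<in>C. \<mu> + s * t \<le> dotp n c (\<lambda>j. p j + s * d j - z j)"
  proof
    fix z assume "z \<in> Z"
    then have z: "z \<in> integer_lattice n" by (simp add: Z_def)
    show "\<forall>\<^sub>F s in at_right 0. \<exists>c\<in>C. \<mu> + s * t \<le> dotp n c (\<lambda>j. p j + s * d j - z j)"
    proof (cases "covers \<mu> (p - z)")
      case True
      obtain c where c: "c \<in> C" "\<mu> \<le> dotp n c (p - z)"
        using p z unfolding last_covered_def by blast
      with True z have "(z, c) \<in> active \<mu> p" by (auto simp: active_def covers_def order_antisym)
      then have "dotp n c d = t" by (rule act)
      with c show ?thesis by (intro always_eventually allI bexI[of _ c]) (simp_all add: line)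
    next
      case False
      then obtain c where c: "c \<in> C" "\<mu> < dotp n c (p - z)" by (auto simp: covers_def not_le)
      have "((\<lambda>s. dotp n c (p - z) + s * dotp n c d - (\<mu> + s * t)) \<longlongrightarrow>
          dotp n c (p - z) + 0 * dotp n c d - (\<mu> + 0 * t)) (at_right 0)"
        by (intro tendsto_intros)
      then have "\<forall>\<^sub>F s in at_right 0. 0 < dotp n c (p - z) + s * dotp n c d - (\<mu> + s * t)"
        using c(2) by (intro order_tendstoD(1)) auto
      then show ?thesis by eventually_elim (use c(1) in \<open>auto simp: line intro!: bexI[of _ c]\<close>)
    qed
  qed
  ultimately have "\<forall>\<^sub>F s in at_right 0. \<forall>z\<in>Z. \<exists>c\<in>C. \<mu> + s * t \<le> dotp n c (\<lambda>j. p j + s * d j - z j)"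
    by (rule eventually_ball_finite)
  moreover have "\<forall>\<^sub>F s in at_right 0. 0 < s \<and> s < (1 :: real)"
    by (intro eventually_conj eventually_at_right_less eventually_at_rightI[of _ 1]) auto
  ultimately show ?thesis
  proof eventually_elim
    case (elim s)
    show ?case
    proof
      fix z assume z: "z \<in> integer_lattice n"
      show "\<exists>c\<in>C. \<mu> + s * t \<le> dotp n c (\<lambda>j. p j + s * d j - z j)"
      proof (rule ccontr)
        \<comment> \<open>Lattice points outside \<open>Z\<close> never violate the inequality: a
          violation puts the moved point into the translate at level \<open>\<nu>\<close>, and this
          forces \<open>z\<close> into \<open>Z\<close>.\<close>
        assume neg: "\<not> ?thesis"
        have "s * t \<le> t" using elim t by (simp add: mult_left_le_one_le)
        then have "covers \<nu> (\<lambda>j. p j + s * d j - z j)"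
          using neg by (force simp: covers_def \<nu>_def not_le)
        moreover have "(\<lambda>j. p j + s * d j - z j) \<in> real_space n"
          using p_real d z by (simp add: real_space_iff integer_lattice_def)
        ultimately have bd: "\<bar>p j + s * d j - z j\<bar> \<le> \<nu> * \<beta>" if "j < n" for j
          using covers_bounded \<nu> that by blast
        have "\<bar>z j\<bar> \<le> B" if "j < n" for j
        proof -
          have "\<bar>p j\<bar> \<le> (\<Sum>j<n. \<bar>p j\<bar>)" "\<bar>d j\<bar> \<le> (\<Sum>j<n. \<bar>d j\<bar>)"
            using that by (auto intro!: member_le_sum)
          moreover have "\<bar>s * d j\<bar> \<le> \<bar>d j\<bar>" using elim by (simp add: abs_mult mult_left_le_one_le)
          ultimately show ?thesis using bd[OF that] unfolding B_def by linarith
        qed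
        then have "- B \<le> z j \<and> z j \<le> B" if "j < n" for j
          using that by (meson abs_le_D1 abs_le_D2 minus_le_iff)
        then have "z \<in> Z" using z by (simp add: Z_def)
        with elim neg show False by blast
      qed
    qed
  qed
qed

text \<open>Each lattice point contributes a finite union of closed half-spaces, so the intersection
  over infinitely many lattice points is still closed; \<open>covers \<nu>\<close> bounds
  it.\<close>

lemma compact_last_covered:
  assumes "0 \<le> \<nu>"
  shows "compact {p. last_covered \<mu> p \<and> covers \<nu> p}"
proof -
  let ?K = "{p. last_covered \<mu> p \<and> covers \<nu> p}"
  \<comment> \<open>\<open>\<nu>\<close> may be 0, while \<open>covers_bounded\<close> needs a
    positive level; hence \<open>\<nu> + 1\<close>.\<close>
  define b where "b = (\<nu> + 1) * \<beta>"
  have "closed (real_space n \<inter> ((\<Inter>z\<in>integer_lattice n. \<Union>c\<in>C. {p. \<mu> \<le> dotp n c p - dotp n c z})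
      \<inter> (\<Inter>c\<in>C. {p. dotp n c p \<le> \<nu>})))"
    by (intro closed_Int closed_real_space closed_INT closed_UN finite_C ballI closed_Collect_le
        continuous_intros continuous_on_dotp)
  moreover have "real_space n \<inter> ((\<Inter>z\<in>integer_lattice n. \<Union>c\<in>C. {p. \<mu> \<le> dotp n c p - dotp n c z})
      \<inter> (\<Inter>c\<in>C. {p. dotp n c p \<le> \<nu>})) = ?K"
    by (auto simp: last_covered_def covers_def dotp_diff)
  ultimately have closed: "closed ?K" by simp
  have "?K \<subseteq> {x \<in> real_space n. \<forall>j<n. - b \<le> x j \<and> x j \<le> b}"
  proof
    fix x assume "x \<in> ?K"
    then have x: "x \<in> real_space n" "covers (\<nu> + 1) x"
      by (auto simp: last_covered_def intro: covers_mono)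
    have "\<bar>x j\<bar> \<le> b" if "j < n" for j
      unfolding b_def by (rule covers_bounded[OF x(2,1) _ that]) (use assms in simp)
    then have "- b \<le> x j \<and> x j \<le> b" if "j < n" for j
      using that by (meson abs_le_D1 abs_le_D2 minus_le_iff)
    with x(1) show "x \<in> {x \<in> real_space n. \<forall>j<n. - b \<le> x j \<and> x j \<le> b}" by simp
  qed
  then have "{x \<in> real_space n. \<forall>j<n. - b \<le> x j \<and> x j \<le> b} \<inter> ?K = ?K" by blast
  with compact_Int_closed[OF compact_real_box closed, of n "- b" b] show ?thesis by simp
qed

lemma active_translate:
  assumes "(z, c) \<in> active \<mu> p" "y \<in> integer_lattice n"
  shows "(z - y, c) \<in> active \<mu> (p - y)"
  using assms by (simp add: active_def integer_lattice_diff)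

text \<open>The assumption \<open>ext\<close> is the extremality of \<open>x\<close> among the last
  covered points that belong to \<mu>P itself.\<close>

lemma active_affinely_spanning:
  assumes "0 \<le> \<mu>" "lattice_covers \<mu>" and x: "last_covered \<mu> x" "covers \<mu> x"
    and ext: "\<And>d. d \<in> real_space n \<Longrightarrow> last_covered \<mu> (x + d) \<Longrightarrow> covers \<mu> (x + d) \<Longrightarrow>
      last_covered \<mu> (x - d) \<Longrightarrow> covers \<mu> (x - d) \<Longrightarrow> d = 0"
    and d: "d \<in> real_space n" "\<And>z c. (z, c) \<in> active \<mu> x \<Longrightarrow> dotp n c d = t"
  shows "t = 0 \<and> d = 0"
proof -
  have x_real: "x \<in> real_space n" using x(1) by (simp add: last_covered_def)
  have nonpos: False if t: "0 < t" and d: "d \<in> real_space n" "\<And>z c. (z, c) \<in> active \<mu> x \<Longrightarrow> dotp n c d = t"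
    for t d
  proof -
    have "\<forall>\<^sub>F s in at_right (0 :: real). 0 < s \<and>
        (\<forall>z\<in>integer_lattice n. \<exists>c\<in>C. \<mu> + s * t \<le> dotp n c (\<lambda>j. x j + s * d j - z j))"
      using t by (intro eventually_conj eventually_at_right_less
          eventually_last_covered[OF x(1) d(1) assms(1) _ d(2)]) auto
    then obtain s where s: "0 < s"
      "\<forall>z\<in>integer_lattice n. \<exists>c\<in>C. \<mu> + s * t \<le> dotp n c (\<lambda>j. x j + s * d j - z j)"
      using eventually_happens[of _ "at_right (0 :: real)"] by force
    have "(\<lambda>j. x j + s * d j) \<in> real_space n" using x_real d(1) by (simp add: real_space_iff)
    then obtain z where z: "z \<in> integer_lattice n" "covers \<mu> ((\<lambda>j. x j + s * d j) - z)"
      using assms(2) unfolding lattice_covers_def by blast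
    have "(\<lambda>j. x j + s * d j) - z = (\<lambda>j. x j + s * d j - z j)" by (simp add: fun_eq_iff)
    with z s(2) obtain c where "\<mu> + s * t \<le> dotp n c (\<lambda>j. x j + s * d j - z j)"
      "dotp n c (\<lambda>j. x j + s * d j - z j) \<le> \<mu>"
      unfolding covers_def by force
    moreover have "0 < s * t" using s(1) t by simp
    ultimately show False by linarith
  qed
  have t: "t = 0"
  proof (rule ccontr)
    assume "t \<noteq> 0"
    then consider "0 < t" | "0 < - t" by linarith
    then show False
    proof cases
      case 1
      then show ?thesis using nonpos d by blast
    next
      case 2
      have "- d \<in> real_space n" using d(1) by (rule real_space_uminus)
      moreover have "dotp n c (- d) = - t" if "(z, c) \<in> active \<mu> x" for z c
        using d(2)[OF that] by (simp add: dotp_uminus)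
      ultimately show ?thesis using nonpos[OF 2] by blast
    qed
  qed
  \<comment> \<open>Staying inside \<mu>P needs no further condition on \<open>d\<close>: a facet of
    \<mu>P tight at \<open>x\<close> gives the active pair (0, c), whose functional is constant
    along \<open>d\<close>; the other facets are slack at \<open>x\<close>.\<close>
  have stay: "\<forall>\<^sub>F s in at_right 0. last_covered \<mu> (\<lambda>j. x j + s * d j) \<and> covers \<mu> (\<lambda>j. x j + s * d j)"
    if d: "d \<in> real_space n" "\<And>z c. (z, c) \<in> active \<mu> x \<Longrightarrow> dotp n c d = 0" for d
  proof (rule eventually_conj)
    have eq: "(\<lambda>j. x j + s * d j) - z = (\<lambda>j. x j + s * d j - z j)" for s z by (simp add: fun_eq_iff)
    show "\<forall>\<^sub>F s in at_right 0. last_covered \<mu> (\<lambda>j. x j + s * d j)"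
      using eventually_last_covered[OF x(1) d(1) assms(1) _ d(2)] x_real d(1)
      by (simp add: last_covered_def eq real_space_iff)
    have "\<forall>\<^sub>F s in at_right 0. \<forall>c\<in>C. dotp n c (\<lambda>j. x j + s * d j) \<le> \<mu>"
    proof (intro eventually_ball_finite finite_C ballI)
      fix c assume c: "c \<in> C"
      show "\<forall>\<^sub>F s in at_right 0. dotp n c (\<lambda>j. x j + s * d j) \<le> \<mu>"
      proof (cases "dotp n c x = \<mu>")
        case True
        then have "(0, c) \<in> active \<mu> x" using c x(2) by (simp add: active_def integer_lattice_zero)
        with True d(2) show ?thesis by (simp add: dotp_line)
      next
        case False
        then have "dotp n c x < \<mu>" using x(2) c by (simp add: covers_def order.not_eq_order_implies_strict)
        moreover have "((\<lambda>s. dotp n c x + s * dotp n c d) \<longlongrightarrow> dotp n c x + 0 * dotp n c d) (at_right 0)"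
          by (intro tendsto_intros)
        ultimately have "\<forall>\<^sub>F s in at_right 0. dotp n c x + s * dotp n c d < \<mu>"
          by (intro order_tendstoD(2)) auto
        then show ?thesis by eventually_elim (simp add: dotp_line)
      qed
    qed
    then show "\<forall>\<^sub>F s in at_right 0. covers \<mu> (\<lambda>j. x j + s * d j)" by (simp add: covers_def)
  qed
  have "\<forall>\<^sub>F s in at_right (0 :: real). 0 < s \<and>
      (last_covered \<mu> (\<lambda>j. x j + s * d j) \<and> covers \<mu> (\<lambda>j. x j + s * d j)) \<and>
      (last_covered \<mu> (\<lambda>j. x j + s * (- d) j) \<and> covers \<mu> (\<lambda>j. x j + s * (- d) j))"
  proof (intro eventually_conj[OF eventually_at_right_less] eventually_conj[OF stay stay])
    show "- d \<in> real_space n" using d(1) by (rule real_space_uminus)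
    show "dotp n c (- d) = 0" if "(z, c) \<in> active \<mu> x" for z c
      using d(2)[OF that] t by (simp add: dotp_uminus)
  qed (use d t in auto)
  then obtain s where s: "0 < s"
    "last_covered \<mu> (\<lambda>j. x j + s * d j)" "covers \<mu> (\<lambda>j. x j + s * d j)"
    "last_covered \<mu> (\<lambda>j. x j + s * (- d) j)" "covers \<mu> (\<lambda>j. x j + s * (- d) j)"
    using eventually_happens[of _ "at_right (0 :: real)"] by force
  have "(\<lambda>j. s * d j) = 0"
  proof (rule ext)
    show "(\<lambda>j. s * d j) \<in> real_space n" using d(1) by (rule real_space_scale)
    have "x + (\<lambda>j. s * d j) = (\<lambda>j. x j + s * d j)" "x - (\<lambda>j. s * d j) = (\<lambda>j. x j + s * (- d) j)"
      by (simp_all add: fun_eq_iff)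
    with s show "last_covered \<mu> (x + (\<lambda>j. s * d j))" "covers \<mu> (x + (\<lambda>j. s * d j))"
      "last_covered \<mu> (x - (\<lambda>j. s * d j))" "covers \<mu> (x - (\<lambda>j. s * d j))" by simp_all
  qed
  with s(1) have "d = 0" by (simp add: fun_eq_iff)
  with t show ?thesis by simp
qed

lemma exists_critical_point:
  assumes "0 < \<mu>0" "\<And>x. x \<in> unit_cube n \<Longrightarrow> covers \<mu>0 x"
  obtains \<mu> p as where "0 \<le> \<mu>" "\<mu> \<le> \<mu>0" "lattice_covers \<mu>" "last_covered \<mu> p" "p \<in> unit_cube n"
    "length as = Suc n" "set as \<subseteq> active \<mu> p" "affinely_spanning n (snd ` set as)"
proof -
  obtain \<mu> p where \<mu>: "0 \<le> \<mu>" "\<mu> \<le> \<mu>0" "lattice_covers \<mu>" and p: "last_covered \<mu> p"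
    using exists_last_covered[OF assms] by blast
  let ?K = "{p. last_covered \<mu> p \<and> covers \<mu> p}"
  obtain z where "z \<in> integer_lattice n" "covers \<mu> (p - z)"
    using \<mu>(3) p unfolding lattice_covers_def last_covered_def by blast
  with last_covered_translate[OF p] have "?K \<noteq> {}" by blast
  moreover have "?K \<subseteq> real_space n" by (auto simp: last_covered_def)
  ultimately obtain x where x: "x \<in> ?K" and
    ext: "\<And>d. d \<in> real_space n \<Longrightarrow> x + d \<in> ?K \<Longrightarrow> x - d \<in> ?K \<Longrightarrow> d = 0"
    by (rule exists_extreme_point[OF compact_last_covered[OF \<mu>(1), of \<mu>]]) blast
  have "t = 0 \<and> d = 0" if "d \<in> real_space n" "\<forall>a\<in>active \<mu> x. dotp n (snd a) d = t" for t d
  proof (rule active_affinely_spanning[OF \<mu>(1,3) _ _ _ that(1)])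
    show "last_covered \<mu> x" "covers \<mu> x" using x by auto
  qed (use ext that(2) in auto)
  then have "affinely_spanning n (snd ` active \<mu> x)"
    unfolding affinely_spanning_def by blast
  then obtain as where as: "length as = Suc n" "set as \<subseteq> active \<mu> x"
    and span: "affinely_spanning n (snd ` set as)"
    using exists_affinely_independent by blast
  \<comment> \<open>Translation into the unit cube shifts the lattice parts of the active pairs and
    leaves the functionals alone, so affine spanning is preserved.\<close>
  let ?y = "lattice_floor n x"
  let ?as = "map (\<lambda>(z, c). (z - ?y, c)) as"
  show thesis
  proof (rule that[OF \<mu>, of "x - ?y" ?as])
    show "last_covered \<mu> (x - ?y)" using last_covered_translate[OF _ lattice_floor_in] x by blast
    show "x - ?y \<in> unit_cube n"
      using x by (intro fractional_part_in_unit_cube) (simp add: last_covered_def)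
    show "set ?as \<subseteq> active \<mu> (x - ?y)"
      using as(2) active_translate[OF _ lattice_floor_in] by auto
    have "snd ` set ?as = snd ` set as" by (simp add: image_image case_prod_unfold)
    with span show "affinely_spanning n (snd ` set ?as)" by simp
  qed (use as in simp)
qed

end

section \<open>Vertices of integer polytopes\<close>

text \<open>Leibniz formula: n! terms, each a product of n entries bounded by \<open>N\<close>. This
  is the source of \<beta>_0.\<close>

lemma abs_det_le:
  fixes A :: "real Matrix.mat"
  assumes "A \<in> carrier_mat n n" "\<And>i j. i < n \<Longrightarrow> j < n \<Longrightarrow> \<bar>A $$ (i, j)\<bar> \<le> N"
  shows "\<bar>Determinant.det A\<bar> \<le> fact n * N ^ n"
proof -
  have "\<bar>Determinant.det A\<bar> \<le> (\<Sum>p | p permutes {0..<n}. \<bar>of_int (sign p) * (\<Prod>i = 0..<n. A $$ (i, p i))\<bar>)"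
    unfolding det_def'[OF assms(1)] by (rule sum_abs)
  also have "\<dots> \<le> (\<Sum>p | p permutes {0..<n}. N ^ n)"
  proof (rule sum_mono)
    fix p assume "p \<in> {p. p permutes {0..<n}}"
    then have "p i < n" if "i < n" for i using that permutes_in_image[of p "{0..<n}" i] by simp
    then have "(\<Prod>i = 0..<n. \<bar>A $$ (i, p i)\<bar>) \<le> (\<Prod>i = 0..<n. N)"
      using assms(2) by (intro prod_mono) auto
    then show "\<bar>of_int (sign p) * (\<Prod>i = 0..<n. A $$ (i, p i))\<bar> \<le> N ^ n"
      by (simp add: abs_mult abs_prod sign_def)
  qed
  also have "\<dots> = fact n * N ^ n" by (simp add: card_permutations[OF refl])
  finally show ?thesis .
qed

text \<open>Cramer's rule: the numerator matrix has one column replaced by the right-hand side,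
  which \<open>N\<close> bounds as well, and the denominator is a nonzero integer.\<close>

lemma abs_solution_le:
  fixes A :: "nat \<Rightarrow> nat \<Rightarrow> int" and b :: "nat \<Rightarrow> int" and x :: "nat \<Rightarrow> real"
  assumes ker: "\<And>v :: nat \<Rightarrow> real. (\<And>i. i < n \<Longrightarrow> (\<Sum>j<n. of_int (A i j) * v j) = 0) \<Longrightarrow> \<forall>j<n. v j = 0"
    and x: "\<And>i. i < n \<Longrightarrow> (\<Sum>j<n. of_int (A i j) * x j) = of_int (b i)"
    and A: "\<And>i j. i < n \<Longrightarrow> j < n \<Longrightarrow> \<bar>A i j\<bar> \<le> N" and b: "\<And>i. i < n \<Longrightarrow> \<bar>b i\<bar> \<le> N" and k: "k < n"
  shows "\<bar>x k\<bar> \<le> fact n * of_int N ^ n"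
proof -
  define Ai where "Ai = Matrix.mat n n (\<lambda>(i, j). A i j)"
  define M :: "real Matrix.mat" where "M = map_mat of_int Ai"
  have M: "M \<in> carrier_mat n n" by (simp add: M_def Ai_def)
  have M_mult: "vec_index (M *\<^sub>v v) i = (\<Sum>j<n. of_int (A i j) * vec_index v j)"
    if "i < n" "v \<in> carrier_vec n" for v i
    using that by (simp add: M_def Ai_def scalar_prod_def lessThan_atLeast0)
  have "Determinant.det M \<noteq> 0"
  proof
    assume "Determinant.det M = 0"
    then obtain v where v: "v \<in> carrier_vec n" "v \<noteq> 0\<^sub>v n" "M *\<^sub>v v = 0\<^sub>v n"
      using det_0_iff_vec_prod_zero_field[OF M] by blast
    have "\<forall>j<n. vec_index v j = 0"
    proof (rule ker)
      fix i assume "i < n"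
      with v M_mult[of i v] show "(\<Sum>j<n. of_int (A i j) * vec_index v j) = 0" by simp
    qed
    with v(1,2) show False by auto
  qed
  moreover have "Determinant.det M = of_int (Determinant.det Ai)"
    unfolding M_def by (rule of_int_hom.hom_det)
  ultimately have "1 \<le> \<bar>Determinant.det M\<bar>" by (simp flip: of_int_abs)
  define xv where "xv = Matrix.vec n x"
  have xv: "xv \<in> carrier_vec n" by (simp add: xv_def)
  have "\<bar>Determinant.det (replace_col M (M *\<^sub>v xv) k)\<bar> \<le> fact n * of_int N ^ n"
  proof (rule abs_det_le)
    show "replace_col M (M *\<^sub>v xv) k \<in> carrier_mat n n" using M by (simp add: replace_col_def)
    fix i j assume ij: "i < n" "j < n"
    have "vec_index (M *\<^sub>v xv) i = of_int (b i)"
      using M_mult[OF ij(1) xv] x[OF ij(1)] by (simp add: xv_def)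
    then show "\<bar>replace_col M (M *\<^sub>v xv) k $$ (i, j)\<bar> \<le> of_int N"
      using ij M A[OF ij] b[OF ij(1)] by (simp add: replace_col_def M_def Ai_def flip: of_int_abs)
  qed
  also have "Determinant.det (replace_col M (M *\<^sub>v xv) k) = x k * Determinant.det M"
    using cramer_lemma_mat[OF M xv k] k by (simp add: xv_def)
  finally have "\<bar>x k\<bar> * \<bar>Determinant.det M\<bar> \<le> fact n * of_int N ^ n" by (simp add: abs_mult)
  moreover have "\<bar>x k\<bar> * 1 \<le> \<bar>x k\<bar> * \<bar>Determinant.det M\<bar>"
    using \<open>1 \<le> \<bar>Determinant.det M\<bar>\<close> by (intro mult_left_mono) auto
  ultimately show ?thesis by simp
qed

text \<open>The a priori bound \<open>B\<close> provides compactness and is traded for an explicit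
  one. A coordinate is maximised on a face, and an extreme point of that face has \<open>n\<close>
  independent tight inequalities, to which \<open>abs_solution_le\<close> applies.\<close>

lemma abs_coordinate_le:
  fixes a :: "'f \<Rightarrow> nat \<Rightarrow> int" and b :: "'f \<Rightarrow> int" and I :: "'f set" and n :: nat
  defines "P \<equiv> {x \<in> real_space n. \<forall>f\<in>I. dotp n (\<lambda>j. of_int (a f j)) x \<le> of_int (b f)}"
  assumes I: "finite I" and bounded: "\<And>x j. x \<in> P \<Longrightarrow> j < n \<Longrightarrow> \<bar>x j\<bar> \<le> B"
    and a: "\<And>f j. f \<in> I \<Longrightarrow> j < n \<Longrightarrow> \<bar>a f j\<bar> \<le> N" and b: "\<And>f. f \<in> I \<Longrightarrow> \<bar>b f\<bar> \<le> N"
    and x: "x \<in> P" and k: "k < n"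
  shows "\<bar>x k\<bar> \<le> fact n * of_int N ^ n"
proof -
  have "closed (real_space n \<inter> (\<Inter>f\<in>I. {x. dotp n (\<lambda>j. of_int (a f j)) x \<le> of_int (b f)}))"
    by (intro closed_Int closed_real_space closed_INT ballI closed_Collect_le
        continuous_on_const continuous_on_dotp)
  moreover have "real_space n \<inter> (\<Inter>f\<in>I. {x. dotp n (\<lambda>j. of_int (a f j)) x \<le> of_int (b f)}) = P"
    by (auto simp: P_def)
  ultimately have closed: "closed P" by simp
  have "- B \<le> y j \<and> y j \<le> B" if "y \<in> P" "j < n" for y j
    using bounded[OF that] by linarith
  then have "{x \<in> real_space n. \<forall>j<n. - B \<le> x j \<and> x j \<le> B} \<inter> P = P"
    by (auto simp: P_def)
  with compact_Int_closed[OF compact_real_box closed, of n "- B" B] have compact: "compact P" by simp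
  \<comment> \<open>The two values of \<open>\<sigma>\<close> bound the coordinate from above and
    from below.\<close>
  have "\<sigma> * x k \<le> fact n * of_int N ^ n" if \<sigma>: "\<bar>\<sigma>\<bar> = 1" for \<sigma> :: real
  proof -
    have "continuous_on P (\<lambda>y. \<sigma> * y k)" by (intro continuous_intros continuous_on_coordinate)
    then obtain y0 where y0: "y0 \<in> P" "\<And>y. y \<in> P \<Longrightarrow> \<sigma> * y k \<le> \<sigma> * y0 k"
      using continuous_attains_sup[OF compact] x by blast
    \<comment> \<open>The face of maximisers. The extreme point is taken here and not in
      \<open>P\<close>, so that it still maximises the coordinate.\<close>
    define K where "K = P \<inter> {y. \<sigma> * y k = \<sigma> * y0 k}"
    have "compact K" unfolding K_def
      by (intro compact_Int_closed compact closed_Collect_eq continuous_intros continuous_on_coordinate)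
    moreover have "K \<noteq> {}" "K \<subseteq> real_space n" using y0(1) by (auto simp: K_def P_def)
    ultimately obtain y where y: "y \<in> K" and
      ext: "\<And>d. d \<in> real_space n \<Longrightarrow> y + d \<in> K \<Longrightarrow> y - d \<in> K \<Longrightarrow> d = 0"
      by (rule exists_extreme_point) blast
    have yP: "y \<in> P" and y_max: "\<And>z. z \<in> P \<Longrightarrow> \<sigma> * z k \<le> \<sigma> * y k"
      using y y0(2) by (auto simp: K_def)
    define T where "T = {f \<in> I. dotp n (\<lambda>j. of_int (a f j)) y = of_int (b f)}"
    have stay: "\<forall>\<^sub>F s in at_right 0. (\<lambda>j. y j + s * d j) \<in> P"
      if d: "d \<in> real_space n" "\<forall>f\<in>T. dotp n (\<lambda>j. of_int (a f j)) d = 0" for d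
    proof -
      have "\<forall>\<^sub>F s in at_right 0. \<forall>f\<in>I. dotp n (\<lambda>j. of_int (a f j)) (\<lambda>j. y j + s * d j) \<le> of_int (b f)"
      proof (intro eventually_ball_finite I ballI)
        fix f assume f: "f \<in> I"
        let ?c = "\<lambda>j. real_of_int (a f j)"
        show "\<forall>\<^sub>F s in at_right 0. dotp n ?c (\<lambda>j. y j + s * d j) \<le> of_int (b f)"
        proof (cases "f \<in> T")
          case True
          with d(2) show ?thesis by (simp add: dotp_line T_def)
        next
          case False
          then have "dotp n ?c y < of_int (b f)"
            using yP f by (simp add: P_def T_def order.not_eq_order_implies_strict)
          moreover have "((\<lambda>s. dotp n ?c y + s * dotp n ?c d) \<longlongrightarrow> dotp n ?c y + 0 * dotp n ?c d) (at_right 0)"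
            by (intro tendsto_intros)
          ultimately have "\<forall>\<^sub>F s in at_right 0. dotp n ?c y + s * dotp n ?c d < of_int (b f)"
            by (intro order_tendstoD(2)) auto
          then show ?thesis by eventually_elim (simp add: dotp_line)
        qed
      qed
      then show ?thesis using yP d(1) by (simp add: P_def real_space_iff)
    qed
    have ker: "\<forall>j<n. v j = 0" if v: "\<forall>f\<in>T. (\<Sum>j<n. of_int (a f j) * v j) = 0" for v :: "nat \<Rightarrow> real"
    proof -
      define d where "d j = (if j < n then v j else 0)" for j
      have d_real: "d \<in> real_space n" by (simp add: d_def real_space_iff)
      have d: "\<forall>f\<in>T. dotp n (\<lambda>j. of_int (a f j)) d = 0" using v by (simp add: dotp_def d_def)
      have d': "\<forall>f\<in>T. dotp n (\<lambda>j. of_int (a f j)) (- d) = 0" using d by (simp add: dotp_uminus)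
      have "\<forall>\<^sub>F s in at_right (0 :: real). 0 < s \<and> (\<lambda>j. y j + s * d j) \<in> P \<and> (\<lambda>j. y j + s * (- d) j) \<in> P"
        by (intro eventually_conj eventually_at_right_less stay d_real real_space_uminus d d')
      then obtain s where s: "0 < s" "(\<lambda>j. y j + s * d j) \<in> P" "(\<lambda>j. y j + s * (- d) j) \<in> P"
        using eventually_happens[of _ "at_right (0 :: real)"] by force
      have eq: "y + (\<lambda>j. s * d j) = (\<lambda>j. y j + s * d j)" "y - (\<lambda>j. s * d j) = (\<lambda>j. y j + s * (- d) j)"
        by (simp_all add: fun_eq_iff)
      \<comment> \<open>Moving either way cannot exceed the maximum, so coordinate \<open>k\<close>
        is constant along \<open>d\<close> and both points stay in the face
        \<open>K\<close>.\<close>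
      have "\<sigma> * (s * d k) \<le> 0" "0 \<le> \<sigma> * (s * d k)"
        using y_max[OF s(2)] y_max[OF s(3)] by (simp_all add: algebra_simps)
      then have "\<sigma> * (s * d k) = 0" by simp
      then have "(\<lambda>j. s * d j) = 0"
        using s y by (intro ext real_space_scale d_real) (auto simp: eq K_def algebra_simps)
      with s(1) have "d = 0" by (simp add: fun_eq_iff)
      then show ?thesis by (auto simp: d_def fun_eq_iff split: if_splits)
    qed
    obtain fs where fs: "length fs = n" "set fs \<subseteq> T"
      "\<And>v :: nat \<Rightarrow> real. \<forall>f\<in>set fs. (\<Sum>j<n. of_int (a f j) * v j) = 0 \<Longrightarrow> \<forall>j<n. v j = 0"
      using exists_independent_rows[where A = T and k = n and r = "\<lambda>f j. of_int (a f j)", OF ker] by blast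
    have fs_T: "fs ! i \<in> T" if "i < n" for i using fs that by auto
    have "\<bar>y k\<bar> \<le> fact n * of_int N ^ n"
    proof (rule abs_solution_le[where A = "\<lambda>i. a (fs ! i)" and b = "\<lambda>i. b (fs ! i)"])
      fix v :: "nat \<Rightarrow> real"
      assume "\<And>i. i < n \<Longrightarrow> (\<Sum>j<n. of_int (a (fs ! i) j) * v j) = 0"
      then show "\<forall>j<n. v j = 0" using fs(1) by (intro fs(3)) (auto simp: in_set_conv_nth)
    next
      fix i assume i: "i < n"
      show "(\<Sum>j<n. of_int (a (fs ! i) j) * y j) = of_int (b (fs ! i))"
        using fs_T[OF i] by (simp add: T_def dotp_def)
      show "\<bar>b (fs ! i)\<bar> \<le> N" using fs_T[OF i] b by (simp add: T_def)
      show "\<bar>a (fs ! i) j\<bar> \<le> N" if "j < n" for j using fs_T[OF i] a that by (simp add: T_def)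
    qed (rule k)
    moreover have "\<sigma> * x k \<le> \<sigma> * y k" using y_max x by blast
    moreover have "\<sigma> * y k \<le> \<bar>y k\<bar>" using \<sigma> by (metis abs_ge_self abs_mult mult_1)
    ultimately show ?thesis by linarith
  qed
  from this[of 1] this[of "- 1"] show ?thesis by simp
qed

section \<open>Results of the computations\<close>

lemma timed_simps [simp]:
  "val (return x) = x" "steps (return x) = 0"
  "val (tick x) = x" "steps (tick x) = 1"
  "val (bind_timed c f) = val (f (val c))"
  "steps (bind_timed c f) = steps c + steps (f (val c))"
  by (simp_all add: return_def tick_def bind_timed_def split: timed.splits)

lemma arith_timed_simps [simp]:
  "val (x +\<^sub>t y) = x + y" "steps (x +\<^sub>t y) = 1"
  "val (x -\<^sub>t y) = x - y" "steps (x -\<^sub>t y) = 1"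
  "val (x *\<^sub>t y) = x * y" "steps (x *\<^sub>t y) = 1"
  "val (x /\<^sub>t y) = x / y" "steps (x /\<^sub>t y) = 1"
  "val (x =\<^sub>t y) = (x = y)" "steps (x =\<^sub>t y) = 1"
  "val (x \<le>\<^sub>t y) = (x \<le> y)" "steps (x \<le>\<^sub>t y) = 1"
  "val (x <\<^sub>t y) = (x < y)" "steps (x <\<^sub>t y) = 1"
  by (simp_all add: add_t_def sub_t_def mul_t_def div_t_def eq_t_def le_t_def less_t_def)

lemma val_map_t [simp]: "val (map_t f xs) = map (\<lambda>x. val (f x)) xs"
  by (induction xs) auto

lemma val_fold_t [simp]: "val (fold_t f xs s) = fold (\<lambda>x s. val (f x s)) xs s"
  by (induction xs arbitrary: s) auto

lemma val_all_t [simp]: "val (all_t p xs) \<longleftrightarrow> (\<forall>x\<in>set xs. val (p x))"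
  by (induction xs) auto

lemma val_abs_t [simp]: "val (abs_t x) = \<bar>x\<bar>"
  by (simp add: abs_t_def)

lemma val_max_t [simp]: "val (max_t x y) = max x y"
  by (simp add: max_t_def max_def)

lemma val_power_t [simp]: "val (power_t x k) = x ^ k"
proof -
  have "fold (\<lambda>_ y. x * y) ks s = x ^ length ks * s" for ks :: "nat list" and s
    by (induction ks arbitrary: s) (auto simp: mult_ac)
  then show ?thesis by (simp add: power_t_def)
qed

lemma val_fact_t [simp]: "val (fact_t k) = fact k"
  unfolding fact_t_def val_fold_t arith_timed_simps by (induction k) auto

lemma val_diff_t [simp]: "val (diff_t xs ys) = map2 (-) xs ys"
  by (simp add: diff_t_def case_prod_unfold)

text \<open>Rational rows are paired with real vectors, because the solution supplied by the
  geometry is not yet known to be rational. As \<open>zip\<close> stops at the shorter list, a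
  vector of length \<open>k\<close> tests only the first \<open>k\<close> columns.\<close>

definition rdot :: "rat list \<Rightarrow> real list \<Rightarrow> real" where
  "rdot xs ys = (\<Sum>(x, y)\<leftarrow>zip xs ys. of_rat x * y)"

lemma rdot_simps [simp]:
  "rdot [] ys = 0" "rdot xs [] = 0" "rdot (x # xs) (y # ys) = of_rat x * y + rdot xs ys"
  by (simp_all add: rdot_def)

lemma rdot_append:
  "length xs = length ys \<Longrightarrow> rdot (xs @ xs') (ys @ ys') = rdot xs ys + rdot xs' ys'"
  by (simp add: rdot_def)

lemma val_dot_t: "of_rat (val (dot_t xs ys)) = rdot xs (map of_rat ys)"
proof -
  have "of_rat (fold (\<lambda>(x, y) s. s + x * y) ps s) =
      of_rat s + (\<Sum>(x, y)\<leftarrow>map (\<lambda>(x, y). (x, of_rat y :: real)) ps. of_rat x * y)" for ps s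
    by (induction ps arbitrary: s) (auto simp: of_rat_add of_rat_mult)
  from this[of "zip xs ys" 0] show ?thesis
    by (simp add: dot_t_def rdot_def case_prod_unfold zip_map2 comp_def)
qed

lemma rdot_combination:
  "rdot (map2 (\<lambda>x y. x - q * y) xs ys) w =
    rdot (take (length ys) xs) w - of_rat q * rdot (take (length xs) ys) w"
proof (induction xs arbitrary: ys w)
  case (Cons x xs)
  then show ?case
    by (cases ys; cases w) (auto simp: of_rat_diff of_rat_mult algebra_simps)
qed simp

section \<open>Gaussian elimination: pivots and preserved solutions\<close>

lemma find_pivot_None: "val (find_pivot_t A) = None \<Longrightarrow> r \<in> set A \<Longrightarrow> hd r = 0"
  by (induction A) (auto split: if_splits)

lemma find_pivot_Some:
  "val (find_pivot_t A) = Some (p, rs) \<Longrightarrow>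
    hd p \<noteq> 0 \<and> set A = insert p (set rs) \<and> length A = Suc (length rs)"
  by (induction A arbitrary: rs) (auto split: if_splits)

lemma val_reduce_row_t:
  "val (reduce_row_t p r) = map2 (\<lambda>x y. x - hd r / hd p * y) (tl r) (tl p)"
  by (simp add: reduce_row_t_def case_prod_unfold)

lemma rdot_reduce_row:
  assumes "length r = length p" "p \<noteq> []" "hd p \<noteq> 0"
  shows "rdot (val (reduce_row_t p r)) w =
    rdot (tl r) w - of_rat (hd r / hd p) * rdot (tl p) w"
  unfolding val_reduce_row_t rdot_combination using assms by simp

lemma eliminate_Suc:
  "val (eliminate_t (Suc k) A) = (case val (find_pivot_t A) of None \<Rightarrow> None
    | Some (p, rs) \<Rightarrow> map_option ((#) p) (val (eliminate_t k (map (\<lambda>r. val (reduce_row_t p r)) rs))))"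
  by (simp split: option.splits prod.splits)

declare eliminate_t.simps(2) [simp del]

text \<open>In the absence of a pivot the first column vanishes, and the first unit vector violates
  the kernel hypothesis. Otherwise a kernel vector of the reduced rows extends to one of
  \<open>A\<close>, so the hypothesis passes on. Columns from \<open>k\<close> on, such as
  right-hand sides, are invisible to vectors of length \<open>k\<close>.\<close>

lemma eliminate_not_None:
  assumes "\<And>r. r \<in> set A \<Longrightarrow> length r = l" "k \<le> l"
    and "\<And>v. length v = k \<Longrightarrow> (\<And>r. r \<in> set A \<Longrightarrow> rdot r v = 0) \<Longrightarrow> set v \<subseteq> {0}"
  shows "val (eliminate_t k A) \<noteq> None"
  using assms
proof (induction k arbitrary: A l)
  case (Suc k)
  show ?case
  proof (cases "val (find_pivot_t A)")
    case None
    have "rdot r (1 # replicate k 0) = 0" if "r \<in> set A" for r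
    proof -
      have "rdot xs (replicate k 0) = 0" for xs and k :: nat
        by (induction xs arbitrary: k) (simp_all, case_tac k, simp_all)
      then show ?thesis
        using find_pivot_None[OF None that] Suc.prems(1)[OF that] Suc.prems(2) by (cases r) auto
    qed
    with Suc.prems(3)[of "1 # replicate k 0"] show ?thesis by simp
  next
    case (Some a)
    obtain p rs where a: "a = (p, rs)" by (cases a)
    note piv = find_pivot_Some[OF Some[unfolded a]]
    have len: "length r = l" if "r \<in> insert p (set rs)" for r
      using Suc.prems(1) piv that by blast
    have p: "p \<noteq> []" using len[of p] Suc.prems(2) by auto
    let ?A = "map (\<lambda>r. val (reduce_row_t p r)) rs"
    have "val (eliminate_t k ?A) \<noteq> None"
    proof (rule Suc.IH)
      show "k \<le> l - 1" using Suc.prems(2) by simp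
      show "length r = l - 1" if "r \<in> set ?A" for r
        using that len by (auto simp: val_reduce_row_t)
      fix v :: "real list" assume v: "length v = k" "\<And>r. r \<in> set ?A \<Longrightarrow> rdot r v = 0"
      \<comment> \<open>Solves the pivot row for the first unknown; all other rows then vanish on
        \<open>v0 # v\<close>, since their reduced versions vanish on \<open>v\<close>.\<close>
      define v0 where "v0 = - rdot (tl p) v / of_rat (hd p)"
      have "rdot r (v0 # v) = 0" if "r \<in> set A" for r
      proof (cases "r = p")
        case True
        then show ?thesis using piv p by (cases p) (auto simp: v0_def)
      next
        case False
        with that piv have r: "r \<in> set rs" by auto
        have "rdot (tl r) v = of_rat (hd r / hd p) * rdot (tl p) v"
          using v(2)[of "val (reduce_row_t p r)"] rdot_reduce_row[of r p v] len[of r] len[of p] p piv r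
          by auto
        moreover have "r \<noteq> []" using len[of r] len[of p] p r by auto
        ultimately show ?thesis using piv by (cases r) (auto simp: v0_def of_rat_divide)
      qed
      with Suc.prems(3)[of "v0 # v"] v(1) show "set v \<subseteq> {0}" by simp
    qed
    then show ?thesis by (simp add: eliminate_Suc Some a)
  qed
qed simp

text \<open>
  Row \<open>i\<close> involves only the entries of \<open>w\<close> from index \<open>i\<close> on. Right-hand sides are ordinary last
  columns if \<open>w\<close> is a solution extended by the entry \<open>-1\<close>.
\<close>

primrec triangular_system :: "rat list list \<Rightarrow> real list \<Rightarrow> bool" where
  "triangular_system [] w \<longleftrightarrow> True"
| "triangular_system (r # rs) w \<longleftrightarrow>
    length r = length w \<and> r \<noteq> [] \<and> hd r \<noteq> 0 \<and> rdot r w = 0 \<and> triangular_system rs (tl w)"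

text \<open>A reduced row is a combination of two rows that vanish on \<open>w\<close>, and its
  leading entry is 0; dropping that entry together with the head of \<open>w\<close> keeps it
  vanishing.\<close>

lemma eliminate_triangular:
  assumes "val (eliminate_t k A) = Some rs" "k \<le> length w"
    and "\<And>r. r \<in> set A \<Longrightarrow> length r = length w \<and> rdot r w = 0"
  shows "length rs = k \<and> triangular_system rs w"
  using assms
proof (induction k arbitrary: A w rs)
  case (Suc k)
  then obtain p qs e where piv: "val (find_pivot_t A) = Some (p, qs)"
    and e: "val (eliminate_t k (map (\<lambda>r. val (reduce_row_t p r)) qs)) = Some e" "rs = p # e"
    by (auto simp: eliminate_Suc split: option.splits)
  note piv' = find_pivot_Some[OF piv]
  have len: "length r = length w \<and> rdot r w = 0" if "r \<in> insert p (set qs)" for r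
    using Suc.prems(3) piv' that by blast
  obtain x w' where w: "w = x # w'" using Suc.prems(2) by (cases w) auto
  obtain y p' where p: "p = y # p'" using len[of p] w by (cases p) auto
  have "length e = k \<and> triangular_system e w'"
  proof (rule Suc.IH[OF e(1)])
    show "k \<le> length w'" using Suc.prems(2) w by simp
    fix r' assume "r' \<in> set (map (\<lambda>r. val (reduce_row_t p r)) qs)"
    then obtain r where r: "r \<in> set qs" "r' = val (reduce_row_t p r)" by auto
    obtain z r'' where r'': "r = z # r''" using len[of r] w r by (cases r) auto
    have "rdot r' w' = rdot r'' w' - of_rat (z / y) * rdot p' w'"
      using len[of r] len[of p] r p r'' piv' rdot_reduce_row[of r p w'] by simp
    moreover have "rdot r'' w' = - of_rat z * x" "rdot p' w' = - of_rat y * x"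
      using len[of r] len[of p] r p r'' w by simp_all
    moreover have "y \<noteq> 0" using piv' p by simp
    ultimately show "length r' = length w' \<and> rdot r' w' = 0"
      using len[of r] len[of p] r p r'' w by (simp add: val_reduce_row_t of_rat_divide)
  qed
  then show ?case using e(2) len[of p] piv' w p by auto
qed simp

text \<open>Nonzero pivots determine the entries of \<open>v\<close> from the last one backwards, so
  the computed rationals must be the given real solution.\<close>

lemma back_substitute_solution:
  assumes "triangular_system rs (v @ [- 1])" "length v = length rs"
  shows "map of_rat (val (back_substitute_t rs)) = v"
  using assms
proof (induction rs arbitrary: v)
  case (Cons r rs)
  obtain x v' where v: "v = x # v'" using Cons.prems(2) by (cases v) auto
  obtain a bs b where r: "r = a # bs @ [b]" "length bs = length v'"
  proof -
    from Cons.prems(1) v have "length r = Suc (Suc (length v'))" by simp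
    then obtain a t where "r = a # t" "length t = Suc (length v')" by (auto simp: length_Suc_conv)
    then show thesis using that[of a "butlast t" "last t"] by (cases t rule: rev_cases) auto
  qed
  have IH: "map of_rat (val (back_substitute_t rs)) = v'"
    using Cons v by simp
  have "of_rat a * x + rdot bs v' = of_rat b" "a \<noteq> 0"
    using Cons.prems(1) v r by (simp_all add: rdot_append)
  then have "x = (of_rat b - rdot bs v') / of_rat a" by (simp add: field_simps)
  then show ?case
    by (simp add: r v IH of_rat_divide of_rat_diff val_dot_t)
qed simp

lemma solve_eq_Some:
  assumes "\<And>r. r \<in> set A \<Longrightarrow> length r = Suc k \<and> rdot r (v @ [- 1]) = 0" "length v = k"
    and "\<And>v. length v = k \<Longrightarrow> (\<And>r. r \<in> set A \<Longrightarrow> rdot r v = 0) \<Longrightarrow> set v \<subseteq> {0}"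
  shows "\<exists>xs. val (solve_t k A) = Some xs \<and> map of_rat xs = v"
proof -
  have "val (eliminate_t k A) \<noteq> None"
    by (rule eliminate_not_None[of A "Suc k"]) (use assms in auto)
  then obtain rs where rs: "val (eliminate_t k A) = Some rs" by blast
  have "length rs = k \<and> triangular_system rs (v @ [- 1])"
    by (rule eliminate_triangular[OF rs]) (use assms in auto)
  then show ?thesis
    using back_substitute_solution[of rs v] assms(2) by (simp add: solve_t_def rs)
qed

lemma length_back_substitute [simp]: "length (val (back_substitute_t rs)) = length rs"
  by (induction rs) auto

lemma length_eliminate: "val (eliminate_t k A) = Some rs \<Longrightarrow> length rs = k"
  by (induction k arbitrary: A rs) (auto simp: eliminate_Suc split: option.splits)

lemma length_solve: "val (solve_t k A) = Some xs \<Longrightarrow> length xs = k"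
  by (auto simp: solve_t_def dest: length_eliminate split: option.splits)

section \<open>Enumerated lists and the facet norm\<close>

lemma val_tuples_t: "set (val (tuples_t k xs)) = {ys. length ys = k \<and> set ys \<subseteq> set xs}"
proof (induction k)
  case (Suc k)
  then show ?case by (auto simp: length_Suc_conv image_iff)
qed auto

declare count_up_t.simps [simp del]

lemma val_count_up_t: "val (count_up_t k M) = map (\<lambda>i. k + of_nat i) [0..<nat (\<lfloor>M - k\<rfloor> + 1)]"
proof (induction k M rule: count_up_t.induct)
  case (1 k M)
  show ?case
  proof (cases "k \<le> M")
    case True
    define d where "d = nat (\<lfloor>M - (k + 1)\<rfloor> + 1)"
    have "\<lfloor>M - k\<rfloor> \<ge> 0" using True by simp
    moreover have "\<lfloor>M - (k + 1)\<rfloor> = \<lfloor>M - k\<rfloor> - 1"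
      by (metis diff_diff_add floor_diff_one)
    ultimately have "nat (\<lfloor>M - k\<rfloor> + 1) = Suc d"
      by (simp add: d_def Suc_nat_eq_nat_zadd1 add.commute)
    moreover have "val (count_up_t k M) = k # val (count_up_t (k + 1) M)"
      using True by (subst count_up_t.simps) simp
    moreover have "val (count_up_t (k + 1) M) = map (\<lambda>i. k + 1 + of_nat i) [0..<d]"
      unfolding d_def using True by (intro 1) auto
    ultimately show ?thesis by (simp add: upt_conv_Cons map_Suc_upt[symmetric] comp_def add_ac del: upt_Suc)
  next
    case False
    then have "\<lfloor>M - k\<rfloor> < 0" by (simp add: floor_less_iff)
    then have "nat (\<lfloor>M - k\<rfloor> + 1) = 0" by linarith
    then show ?thesis using False by (subst count_up_t.simps) simp
  qed
qed

lemma set_lattice_coordinates: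
  fixes M :: nat
  shows "set (map (\<lambda>k. 0 - k) (val (count_up_t 0 (of_nat M))) @ map (\<lambda>k. k + 1) (val (count_up_t 0 (of_nat M))))
    = {of_int i | i. - int M \<le> i \<and> i \<le> int M + 1}" (is "?L = ?R")
proof -
  have "?L = (\<lambda>i. - of_nat i) ` {0..M} \<union> (\<lambda>i. of_nat i + 1) ` {0..M}"
    by (auto simp: val_count_up_t nat_add_distrib image_image image_iff)
  also have "\<dots> = ?R"
  proof (intro Set.set_eqI iffI)
    fix x assume "x \<in> (\<lambda>i. - of_nat i) ` {0..M} \<union> (\<lambda>i. of_nat i + 1 :: rat) ` {0..M}"
    then consider i where "i \<le> M" "x = of_int (- int i)" | i where "i \<le> M" "x = of_int (int i + 1)"
      by auto
    then show "x \<in> ?R"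
    proof cases
      case 1
      then show ?thesis by (intro CollectI exI[of _ "- int i"]) auto
    next
      case 2
      then show ?thesis by (intro CollectI exI[of _ "int i + 1"]) auto
    qed
  next
    fix x assume "x \<in> ?R"
    then obtain i where i: "x = of_int i" "- int M \<le> i" "i \<le> int M + 1" by auto
    show "x \<in> (\<lambda>i. - of_nat i) ` {0..M} \<union> (\<lambda>i. of_nat i + 1 :: rat) ` {0..M}"
    proof (cases "i \<le> 0")
      case True
      then have "x = - of_nat (nat (- i))" "nat (- i) \<in> {0..M}" using i by auto
      then show ?thesis by blast
    next
      case False
      then have "x = of_nat (nat (i - 1)) + 1" "nat (i - 1) \<in> {0..M}" using i by auto
      then show ?thesis by blast
    qed
  qed
  finally show ?thesis .
qed

lemma val_lattice_points_t:
  "set (val (lattice_points_t n (of_nat M))) =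
    {zs. length zs = n \<and> (\<forall>z\<in>set zs. \<exists>i. z = of_int i \<and> - int M \<le> i \<and> i \<le> int M + 1)}"
proof -
  have "set (val (lattice_points_t n (of_nat M))) = {ys. length ys = n \<and> set ys \<subseteq> 
     {of_int i | i. - int M \<le> i \<and> i \<le> int M + 1}}"
    unfolding lattice_points_t_def timed_simps val_tuples_t val_map_t arith_timed_simps set_lattice_coordinates ..
  then show ?thesis by blast
qed

lemma val_facet_norm_t:
  assumes "integer_facet_description n F" "F \<noteq> []" "n \<ge> 1"
  shows "val (facet_norm_t (rational_facets F)) = of_int (facet_norm F)"
proof -
  define h :: "int facet \<Rightarrow> int" where "h f = max (sup_norm (fst f)) (snd f)" for f
  have facet: "fst f \<noteq> []" "0 < snd f" if "f \<in> set F" for f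
    using assms that by (auto simp: integer_facet_description_def)
  have inner: "fold (\<lambda>c t. max \<bar>c\<bar> t) (map of_int a) (of_int s) = (of_int (max (sup_norm a) s) :: rat)"
    if "a \<noteq> []" for a s
  proof -
    have "fold (\<lambda>c t. max \<bar>c\<bar> t) (map of_int a) (of_int s) = (of_int (fold max (map abs a) s) :: rat)"
    proof (induction a arbitrary: s)
      case (Cons c a)
      from Cons[of "max \<bar>c\<bar> s"] show ?case by (simp add: of_int_max)
    qed simp
    also have "fold max (map abs a) s = Max (insert s (abs ` set a))"
      by (subst Max.set_eq_fold[symmetric]) simp
    also have "\<dots> = max (sup_norm a) s" using that by (simp add: sup_norm_def max.commute)
    finally show ?thesis .
  qed
  have "fold (\<lambda>(a, b) s. max b (fold (\<lambda>c t. max \<bar>c\<bar> t) a s)) (rational_facets G) (of_int s) =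
      of_int (fold max (map h G) s)" if "set G \<subseteq> set F" for G s
    using that
  proof (induction G arbitrary: s)
    case (Cons f G)
    obtain a b where f: "f = (a, b)" by (cases f)
    then have "a \<noteq> []" using facet[of f] Cons.prems by simp
    then have "max (of_int b) (fold (\<lambda>c t. max \<bar>c\<bar> t) (map of_int a) (of_int s)) =
        (of_int (max (h f) s) :: rat)"
      unfolding inner[OF \<open>a \<noteq> []\<close>] by (simp add: f h_def of_int_max max.assoc max.left_commute)
    with Cons.IH[of "max (h f) s"] Cons.prems show ?case
      by (simp add: f rational_facets_def)
  qed (simp add: rational_facets_def)
  from this[of F 0] have "val (facet_norm_t (rational_facets F)) = of_int (fold max (map h F) 0)"
    by (simp add: facet_norm_t_def case_prod_unfold)
  also have "fold max (map h F) 0 = Max (insert 0 (h ` set F))"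
    by (subst Max.set_eq_fold[symmetric]) simp
  also have "\<dots> = facet_norm F"
  proof (rule order_antisym)
    \<comment> \<open>The fold starts at 0, which is not among the numbers maximised by
      \<open>facet_norm\<close>; this is harmless because the offsets are positive.\<close>
    have "0 \<le> facet_norm F"
    proof -
      have "snd (hd F) \<le> facet_norm F" using assms(2) by (auto simp: facet_norm_def)
      then show ?thesis using facet(2)[of "hd F"] assms(2) by simp
    qed
    then show "Max (insert 0 (h ` set F)) \<le> facet_norm F"
      by (auto simp: h_def facet_norm_def)
    show "facet_norm F \<le> Max (insert 0 (h ` set F))"
      unfolding facet_norm_def using assms(2)
    proof (subst Max_le_iff, simp, simp, intro ballI)
      fix k assume "k \<in> (sup_norm \<circ> fst) ` set F \<union> snd ` set F"
      then obtain f where "f \<in> set F" "k \<le> h f" by (auto simp: h_def)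
      then show "k \<le> Max (insert 0 (h ` set F))" by (auto simp: Max_ge_iff)
    qed
  qed
  finally show ?thesis .
qed

section \<open>Lists as vectors, and the tests on candidates\<close>

lemma rdot_eq_sum: "length xs = n \<Longrightarrow> length v = n \<Longrightarrow> rdot xs v = (\<Sum>j<n. of_rat (xs ! j) * v ! j)"
  by (simp add: rdot_def sum_list_sum_nth lessThan_atLeast0)

definition list_vector :: "real list \<Rightarrow> nat \<Rightarrow> real" where
  "list_vector v j = (if j < length v then v ! j else 0)"

lemma list_vector_real_space: "length v = n \<Longrightarrow> list_vector v \<in> real_space n"
  by (simp add: list_vector_def real_space_iff)

lemma rdot_eq_dotp:
  "length xs = n \<Longrightarrow> length v = n \<Longrightarrow> rdot xs v = dotp n (list_vector (map of_rat xs)) (list_vector v)"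
  by (simp add: rdot_eq_sum dotp_def list_vector_def)

lemma list_vector_diff:
  "length xs = length ys \<Longrightarrow> list_vector (map of_rat (map2 (-) xs ys)) =
    list_vector (map of_rat xs) - list_vector (map of_rat ys)"
  by (auto simp: list_vector_def fun_eq_iff of_rat_diff)

lemma list_vector_divide:
  "list_vector (map of_rat (map (\<lambda>c. c / q) xs)) = (\<lambda>j. 1 / of_rat q * list_vector (map of_rat xs) j)"
  by (auto simp: list_vector_def fun_eq_iff of_rat_divide)

lemma list_vector_eq_0: "list_vector v = 0 \<Longrightarrow> set v \<subseteq> {0}"
  by (auto simp: in_set_conv_nth list_vector_def fun_eq_iff split: if_splits)

lemma list_vector_map_upt: "x \<in> real_space n \<Longrightarrow> list_vector (map x [0..<n]) = x"
  by (auto simp: list_vector_def fun_eq_iff real_space_iff)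

definition normal :: "int facet \<Rightarrow> nat \<Rightarrow> real" where
  "normal f = list_vector (map (\<lambda>c. of_int c / of_int (snd f)) (fst f))"

lemma list_vector_rational_normal:
  "list_vector (map of_rat (map (\<lambda>c. c / of_int (snd f)) (map of_int (fst f)))) = normal f"
  by (simp add: normal_def comp_def of_rat_divide)

lemma dotp_normal:
  "length (fst f) = n \<Longrightarrow> dotp n (normal f) x = (\<Sum>j<n. of_int (fst f ! j) * x j) / of_int (snd f)"
  by (simp add: dotp_def normal_def list_vector_def sum_divide_distrib)

text \<open>Dividing by \<mu> and comparing with b amounts to c^T y < \<mu>, the exact negation of
  the weak inequality in \<open>last_covered\<close>; the interior enters only through it.\<close>

lemma val_in_interior_t:
  assumes "integer_facet_description n F" "length y = n" "0 < \<mu>"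
  shows "val (in_interior_t (rational_facets F) \<mu> y) \<longleftrightarrow>
    (\<forall>f\<in>set F. dotp n (normal f) (list_vector (map of_rat y)) < of_rat \<mu>)"
proof -
  have "val (dot_t (map of_int (fst f)) (map (\<lambda>c. c / \<mu>) y)) < of_int (snd f) \<longleftrightarrow>
      dotp n (normal f) (list_vector (map of_rat y)) < of_rat \<mu>" if "f \<in> set F" for f
  proof -
    have f: "length (fst f) = n" "0 < snd f"
      using assms(1) that by (auto simp: integer_facet_description_def)
    have "(val (dot_t (map of_int (fst f)) (map (\<lambda>c. c / \<mu>) y)) < of_int (snd f)) =
        (of_rat (val (dot_t (map of_int (fst f)) (map (\<lambda>c. c / \<mu>) y))) < (of_rat (of_int (snd f)) :: real))"
      by (simp only: of_rat_less)
    also have "of_rat (val (dot_t (map of_int (fst f)) (map (\<lambda>c. c / \<mu>) y))) =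
        (\<Sum>j<n. of_int (fst f ! j) * list_vector (map of_rat (map (\<lambda>c. c / \<mu>) y)) j)"
      using f assms(2) by (simp only: val_dot_t) (simp add: rdot_eq_sum list_vector_def)
    also have "\<dots> = of_int (snd f) * dotp n (normal f) (list_vector (map of_rat (map (\<lambda>c. c / \<mu>) y)))"
      using f by (simp add: dotp_normal)
    also have "\<dots> = of_int (snd f) * dotp n (normal f) (list_vector (map of_rat y)) / of_rat \<mu>"
      by (simp only: list_vector_divide dotp_scale) simp
    finally show ?thesis using f assms(3) by (simp add: field_simps)
  qed
  then show ?thesis
    using assms(3) by (auto simp: in_interior_t_def rational_facets_def case_prod_unfold)
qed

lemma val_uncovered_t:
  assumes "integer_facet_description n F" "length p = n" "0 < \<mu>" "\<And>z. z \<in> set L \<Longrightarrow> length z = n"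
  shows "val (uncovered_t (rational_facets F) L \<mu> p) \<longleftrightarrow>
    (\<forall>z\<in>set L. \<exists>f\<in>set F. of_rat \<mu> \<le> dotp n (normal f) (list_vector (map of_rat p) - list_vector (map of_rat z)))"
proof -
  have "val (in_interior_t (rational_facets F) \<mu> (map2 (-) p z)) \<longleftrightarrow>
      (\<forall>f\<in>set F. dotp n (normal f) (list_vector (map of_rat p) - list_vector (map of_rat z)) < of_rat \<mu>)"
    if "z \<in> set L" for z
    using val_in_interior_t[OF assms(1) _ assms(3), of "map2 (-) p z"] assms(2) assms(4)[OF that]
    by (simp add: list_vector_diff del: list.map_comp map_map)
  then show ?thesis by (auto simp: uncovered_t_def not_less)
qed

text \<open>Lets \<open>last_covered_uncovered\<close> treat level 0 without a proof that the
  critical level is positive.\<close>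

lemma uncovered_t_zero: "val (uncovered_t F L 0 p)"
  by (simp add: uncovered_t_def in_interior_t_def)

definition scaled_normals :: "rat facet list \<Rightarrow> rat list list" where
  "scaled_normals fs = map (\<lambda>(a, b). map (\<lambda>c. c / b) a) fs"

definition critical_system :: "rat list list \<Rightarrow> rat list list \<Rightarrow> rat list list" where
  "critical_system cs zs = map (\<lambda>(c, z). - 1 # c @ [val (dot_t c z)]) (zip cs zs)"

lemma val_candidate_step_t:
  "val (candidate_step_t n F L zs fs m) =
    (if val (affinely_independent_t n (scaled_normals fs)) then
       (case val (solve_t (n + 1) (critical_system (scaled_normals fs) zs)) of
          Some (\<mu> # p) \<Rightarrow>
            if (\<forall>c\<in>set p. 0 \<le> c \<and> c \<le> 1) \<and> val (uncovered_t F L \<mu> p) then max \<mu> m else m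
        | _ \<Rightarrow> m)
     else m)"
proof -
  have cs: "val (map_t (\<lambda>(a, b). map_t (\<lambda>c. c /\<^sub>t b) a) fs) = scaled_normals fs"
    by (simp add: scaled_normals_def case_prod_unfold)
  have A: "val (map_t (\<lambda>(c, z). dot_t c z \<bind> (\<lambda>s. return (- 1 # c @ [s]))) (zip cs zs)) = critical_system cs zs"
    for cs by (simp add: critical_system_def case_prod_unfold)
  show ?thesis
    unfolding candidate_step_t_def timed_simps cs
    by (simp add: A in_unit_cube_t_def del: val_map_t split: option.split list.split)
qed

text \<open>Form used for the upper bound: whatever system produced \<mu> and \<open>p\<close>, an
  accepted candidate has passed the cube test and the covering test.\<close>

lemma candidate_step_cases:
  obtains "val (candidate_step_t n F L zs fs m) = m"
  | \<mu> p where "length p = n" "\<forall>c\<in>set p. 0 \<le> c \<and> c \<le> 1" "val (uncovered_t F L \<mu> p)"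
    "val (candidate_step_t n F L zs fs m) = max \<mu> m"
proof -
  let ?sol = "val (solve_t (n + 1) (critical_system (scaled_normals fs) zs))"
  show thesis
  proof (cases "\<exists>\<mu> p. ?sol = Some (\<mu> # p) \<and> val (affinely_independent_t n (scaled_normals fs)) \<and>
      (\<forall>c\<in>set p. 0 \<le> c \<and> c \<le> 1) \<and> val (uncovered_t F L \<mu> p)")
    case True
    then obtain \<mu> p where sol: "?sol = Some (\<mu> # p)"
      and *: "val (affinely_independent_t n (scaled_normals fs))"
        "\<forall>c\<in>set p. 0 \<le> c \<and> c \<le> 1" "val (uncovered_t F L \<mu> p)" by blast
    show thesis
      by (rule that(2)[of p \<mu>]) (use length_solve[OF sol] sol * in \<open>simp_all add: val_candidate_step_t\<close>)
  next
    case False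
    then show thesis
      by (intro that(1)) (auto simp: val_candidate_step_t split: option.splits list.splits)
  qed
qed

lemma fold_between:
  fixes m :: "'a::preorder"
  assumes "\<And>x m. x \<in> set xs \<Longrightarrow> m \<le> q \<Longrightarrow> m \<le> g x m \<and> g x m \<le> q" "m \<le> q"
  shows "m \<le> fold g xs m \<and> fold g xs m \<le> q"
  using assms
proof (induction xs arbitrary: m)
  case (Cons x xs)
  have "m \<le> g x m" "g x m \<le> q" using Cons.prems by auto
  moreover from this(2) have "g x m \<le> fold g xs (g x m) \<and> fold g xs (g x m) \<le> q"
    using Cons.prems(1) by (intro Cons.IH) auto
  ultimately show ?case by (auto intro: order_trans)
qed simp

text \<open>Invariant of a running maximum: it never drops, never exceeds \<open>q\<close>, and one
  iteration lifts it to \<open>q\<close>. Applied to the inner and to the outer loop.\<close>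

lemma fold_reaches:
  fixes m :: "'a::order"
  assumes "\<And>x m. x \<in> set xs \<Longrightarrow> m \<le> q \<Longrightarrow> m \<le> g x m \<and> g x m \<le> q" "m \<le> q"
    and "x \<in> set xs" "\<And>m. m \<le> q \<Longrightarrow> g x m = q"
  shows "fold g xs m = q"
proof -
  obtain ys zs where xs: "xs = ys @ x # zs" using assms(3) by (auto dest: split_list)
  have "fold g ys m \<le> q" using fold_between[of ys q g m] assms(1,2) xs by auto
  then have "fold g xs m = fold g zs q" using assms(4) xs by simp
  moreover have "q \<le> fold g zs q \<and> fold g zs q \<le> q" using fold_between[of zs q g q] assms(1) xs by auto
  ultimately show ?thesis by (simp add: order_antisym)
qed

section \<open>The algorithm on a bounded polytope\<close>

lemma dilate_eq:
  assumes "0 < \<mu>"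
  shows "dilate \<mu> S = {y. (\<lambda>j. y j / \<mu>) \<in> S}"
proof (intro Set.set_eqI iffI)
  fix y assume "y \<in> {y. (\<lambda>j. y j / \<mu>) \<in> S}"
  then have "(\<lambda>j. \<mu> * (y j / \<mu>)) \<in> dilate \<mu> S"
    unfolding dilate_def by (intro image_eqI[where x = "\<lambda>j. y j / \<mu>"]) auto
  with assms show "y \<in> dilate \<mu> S" by simp
qed (use assms in \<open>auto simp: dilate_def\<close>)

locale bounded_integer_polytope =
  fixes n :: nat and F :: "int facet list"
  assumes n_ge: "n \<ge> 1" and facets: "integer_facet_description n F"
    and bounded: "bounded_set n (polyhedron_of n F)"
begin

lemma facetD: "f \<in> set F \<Longrightarrow> length (fst f) = n" "f \<in> set F \<Longrightarrow> 0 < snd f"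
  using facets by (auto simp: integer_facet_description_def)

lemma F_nonempty: "F \<noteq> []"
proof
  assume "F = []"
  obtain B where B: "\<And>x j. x \<in> polyhedron_of n F \<Longrightarrow> j < n \<Longrightarrow> \<bar>x j\<bar> \<le> B"
    using bounded by (auto simp: bounded_set_def)
  have "(\<lambda>j. if j = 0 then B + 1 else 0) \<in> polyhedron_of n F"
    using n_ge \<open>F = []\<close> by (simp add: polyhedron_of_def real_space_iff)
  from B[OF this, of 0] show False using n_ge by simp
qed

lemma abs_normal_le: "\<bar>fst f ! j\<bar> \<le> facet_norm F" if "f \<in> set F" "j < n"
proof -
  have "\<bar>fst f ! j\<bar> \<le> sup_norm (fst f)"
    using that facetD(1)[of f] unfolding sup_norm_def by (intro Max_ge) auto
  also have "\<dots> \<le> facet_norm F" using that unfolding facet_norm_def by (intro Max_ge) auto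
  finally show ?thesis .
qed

lemma offset_le: "f \<in> set F \<Longrightarrow> snd f \<le> facet_norm F"
  unfolding facet_norm_def by (intro Max_ge) auto

lemma facet_norm_ge_1: "1 \<le> facet_norm F"
  using F_nonempty offset_le[of "hd F"] facetD(2)[of "hd F"] by simp

definition N :: nat where "N = nat (facet_norm F)"

lemma N_ge_1: "1 \<le> N" and facet_norm_eq: "facet_norm F = int N"
  using facet_norm_ge_1 by (simp_all add: N_def)

definition b0 :: nat where "b0 = N ^ n * fact n"

lemma N_le_b0: "N \<le> b0"
proof -
  have "N ^ 1 \<le> N ^ n" using N_ge_1 n_ge by (intro power_increasing) auto
  also have "\<dots> * 1 \<le> N ^ n * fact n" by (intro mult_left_mono fact_ge_1) auto
  finally show ?thesis by (simp add: b0_def)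
qed

lemma b0_ge_1: "1 \<le> b0"
  using N_le_b0 N_ge_1 by simp

lemma dotp_normal_le_iff:
  "f \<in> set F \<Longrightarrow> dotp n (normal f) x \<le> r \<longleftrightarrow> (\<Sum>j<n. of_int (fst f ! j) * x j) \<le> r * of_int (snd f)"
  using facetD[of f] by (simp add: dotp_normal pos_divide_le_eq)

lemma polyhedron_of_eq:
  "polyhedron_of n F = {x \<in> real_space n. \<forall>c\<in>normal ` set F. dotp n c x \<le> 1}"
  by (auto simp: polyhedron_of_def dotp_normal_le_iff case_prod_unfold)

text \<open>Boundedness with an unknown \<open>B\<close> is upgraded here to the vertex bound
  \<open>b0\<close>, which is \<beta>_0.\<close>

sublocale gauge n "normal ` set F" "real b0"
proof
  fix x j assume x: "x \<in> real_space n" "\<And>c. c \<in> normal ` set F \<Longrightarrow> dotp n c x \<le> 1" and j: "j < n"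
  obtain B where B: "\<And>x j. x \<in> polyhedron_of n F \<Longrightarrow> j < n \<Longrightarrow> \<bar>x j\<bar> \<le> B"
    using bounded by (auto simp: bounded_set_def)
  have P: "polyhedron_of n F = {x \<in> real_space n. \<forall>f\<in>set F. dotp n (\<lambda>j. of_int (fst f ! j)) x \<le> of_int (snd f)}"
    by (auto simp: polyhedron_of_def dotp_def case_prod_unfold)
  have "\<bar>x j\<bar> \<le> fact n * of_int (facet_norm F) ^ n"
  proof (rule abs_coordinate_le[where I = "set F" and a = "\<lambda>f j. fst f ! j" and b = snd and B = B])
    show "x \<in> {x \<in> real_space n. \<forall>f\<in>set F. dotp n (\<lambda>j. of_int (fst f ! j)) x \<le> of_int (snd f)}"
      using x unfolding P[symmetric] polyhedron_of_eq by simp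
    show "\<bar>snd f\<bar> \<le> facet_norm F" if "f \<in> set F" for f
      using offset_le[OF that] facetD(2)[OF that] by simp
  qed (use B abs_normal_le j in \<open>auto simp flip: P\<close>)
  then show "\<bar>x j\<bar> \<le> real b0" by (simp add: b0_def facet_norm_eq mult.commute)
qed (use n_ge in auto)

text \<open>On the cube a^T x is at most n N, and b \<ge> 1. Level n N would do; it is enlarged to
  \<open>n * b0\<close>, the parameter \<mu>_0 of the algorithm.\<close>

lemma unit_cube_covered:
  assumes "x \<in> unit_cube n"
  shows "covers (real (n * b0)) x"
  unfolding covers_def
proof (intro ballI, elim imageE, simp only:)
  fix f assume f: "f \<in> set F"
  have "(\<Sum>j<n. of_int (fst f ! j) * x j) \<le> (\<Sum>j<n. real N)"
  proof (rule sum_mono)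
    fix j assume "j \<in> {..<n}"
    then have j: "j < n" by simp
    have "of_int (fst f ! j) \<le> real N"
      using abs_normal_le[OF f j] unfolding facet_norm_eq by linarith
    moreover have "0 \<le> x j" "x j \<le> 1" using assms j by (auto simp: unit_cube_def)
    ultimately have "of_int (fst f ! j) * x j \<le> real N * x j" by (intro mult_right_mono)
    also have "\<dots> \<le> real N * 1" using \<open>x j \<le> 1\<close> by (intro mult_left_mono) auto
    finally show "of_int (fst f ! j) * x j \<le> real N" by simp
  qed
  also have "\<dots> \<le> real (n * b0)" using N_le_b0 by (simp add: mult_left_mono)
  also have "\<dots> * 1 \<le> real (n * b0) * of_int (snd f)"
    using facetD(2)[OF f] by (intro mult_left_mono) auto
  finally show "dotp n (normal f) x \<le> real (n * b0)" using f by (simp add: dotp_normal_le_iff)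
qed

lemma dilate_polyhedron:
  assumes "0 \<le> \<mu>"
  shows "dilate \<mu> (polyhedron_of n F) = {y \<in> real_space n. covers \<mu> y}"
proof (cases "\<mu> = 0")
  \<comment> \<open>Both sides collapse to the origin: the dilate because 0 belongs to P, the other
    set because the recession cone is trivial.\<close>
  case True
  have "0 \<in> polyhedron_of n F" by (simp add: polyhedron_of_eq real_space_zero)
  then have "dilate 0 (polyhedron_of n F) = {0}"
    by (auto simp: dilate_def zero_fun_def)
  moreover have "{y \<in> real_space n. covers 0 y} = {0}"
    using recession_trivial by (auto simp: covers_def real_space_zero)
  ultimately show ?thesis using True by simp
next
  case False
  with assms have \<mu>: "0 < \<mu>" by simp
  have "dotp n c (\<lambda>j. y j / \<mu>) = dotp n c y / \<mu>" for c y
    using dotp_scale[of n c "1 / \<mu>" y] by simp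
  then show ?thesis
    using \<mu> by (auto simp: dilate_eq polyhedron_of_eq covers_def real_space_iff pos_divide_le_eq)
qed

lemma covering_iff:
  assumes "0 \<le> \<mu>"
  shows "dilate \<mu> (polyhedron_of n F) + integer_lattice n = real_space n \<longleftrightarrow> lattice_covers \<mu>"
proof
  assume eq: "dilate \<mu> (polyhedron_of n F) + integer_lattice n = real_space n"
  show "lattice_covers \<mu>"
    unfolding lattice_covers_def
  proof
    fix x assume "x \<in> real_space n"
    then obtain y z where "x = y + z" "y \<in> dilate \<mu> (polyhedron_of n F)" "z \<in> integer_lattice n"
      unfolding eq[symmetric] by (auto elim: set_plus_elim)
    then show "\<exists>z\<in>integer_lattice n. covers \<mu> (x - z)"
      by (intro bexI[of _ z]) (simp_all add: dilate_polyhedron[OF assms])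
  qed
next
  assume cov: "lattice_covers \<mu>"
  show "dilate \<mu> (polyhedron_of n F) + integer_lattice n = real_space n"
  proof (intro Set.set_eqI iffI)
    fix x assume "x \<in> dilate \<mu> (polyhedron_of n F) + integer_lattice n"
    then show "x \<in> real_space n"
      by (auto elim!: set_plus_elim simp: dilate_polyhedron[OF assms]
          intro: real_space_add integer_lattice_real_space)
  next
    fix x assume x: "x \<in> real_space n"
    then obtain z where z: "z \<in> integer_lattice n" "covers \<mu> (x - z)"
      using cov unfolding lattice_covers_def by blast
    then have "(x - z) + z \<in> dilate \<mu> (polyhedron_of n F) + integer_lattice n"
      using real_space_diff[OF x integer_lattice_real_space]
      by (intro set_plus_intro) (simp_all add: dilate_polyhedron[OF assms])
    then show "x \<in> dilate \<mu> (polyhedron_of n F) + integer_lattice n" by simp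
  qed
qed

text \<open>A covering level \<nu> covers \<open>p\<close> by some translate, and for that translate
  some functional already takes a value of at least \<mu>.\<close>

lemma covering_radius_eqI:
  assumes "0 \<le> \<mu>" "lattice_covers \<mu>" "last_covered \<mu> p"
  shows "covering_radius n (polyhedron_of n F) = \<mu>"
  unfolding covering_radius_def
proof (rule Least_equality)
  show "0 \<le> \<mu> \<and> dilate \<mu> (polyhedron_of n F) + integer_lattice n = real_space n"
    using assms covering_iff by simp
  fix \<nu> assume "0 \<le> \<nu> \<and> dilate \<nu> (polyhedron_of n F) + integer_lattice n = real_space n"
  then have "lattice_covers \<nu>" using covering_iff by blast
  then obtain z where "z \<in> integer_lattice n" "covers \<nu> (p - z)"
    using assms(3) unfolding lattice_covers_def last_covered_def by blast
  with assms(3) show "\<mu> \<le> \<nu>" unfolding last_covered_def covers_def by (meson order_trans)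
qed

text \<open>The product \<mu>_0 \<beta>_0, with \<beta>_0 = \<open>b0\<close> and \<mu>_0 =
  \<open>n * b0\<close>; being a natural number, it makes the ends of the window integers.\<close>

definition M :: nat where "M = n * b0 * b0"

definition lattice_list :: "rat list list" where
  "lattice_list = val (lattice_points_t n (of_nat M))"

text \<open>The floor is exact at lattice points and only converts integral reals into
  rationals.\<close>

definition lattice_coords :: "(nat \<Rightarrow> real) \<Rightarrow> rat list" where
  "lattice_coords z = map (\<lambda>j. of_int \<lfloor>z j\<rfloor>) [0..<n]"

lemma list_vector_lattice_coords:
  "z \<in> integer_lattice n \<Longrightarrow> list_vector (map of_rat (lattice_coords z)) = z"
  by (auto simp: list_vector_def lattice_coords_def fun_eq_iff integer_lattice_def real_space_iff
      dest: of_int_floor)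

lemma length_lattice_list: "z \<in> set lattice_list \<Longrightarrow> length z = n"
  by (simp add: lattice_list_def val_lattice_points_t)

text \<open>The coordinates of p - z are at most \<mu>_0 \<beta>_0 = \<open>M\<close> in absolute
  value, and p in [0,1]^n adds the 1 at the upper end of the window.\<close>

lemma lattice_coords_in_list:
  assumes "z \<in> integer_lattice n" "p \<in> unit_cube n" "covers \<mu> (p - z)" "\<mu> \<le> real (n * b0)"
  shows "lattice_coords z \<in> set lattice_list"
proof -
  have p: "p \<in> real_space n" using assms(2) by (simp add: unit_cube_def)
  have "- int M \<le> \<lfloor>z j\<rfloor> \<and> \<lfloor>z j\<rfloor> \<le> int M + 1" if j: "j < n" for j
  proof -
    have "covers (real (n * b0)) (p - z)" using covers_mono assms(3,4) by blast
    then have "\<bar>(p - z) j\<bar> \<le> real (n * b0) * real b0"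
      by (rule covers_bounded[OF _ real_space_diff[OF p integer_lattice_real_space[OF assms(1)]] _ j])
        (use n_ge b0_ge_1 in simp)
    then have "\<bar>p j - z j\<bar> \<le> real M" by (simp add: M_def)
    moreover have "0 \<le> p j" "p j \<le> 1" using assms(2) j by (auto simp: unit_cube_def)
    ultimately have "- real M \<le> z j" "z j \<le> real M + 1" by linarith+
    then show ?thesis by linarith
  qed
  then show ?thesis
    unfolding lattice_list_def val_lattice_points_t by (auto simp: lattice_coords_def)
qed

lemma uncovered_le:
  assumes "0 \<le> \<nu>" "lattice_covers \<nu>" "\<nu> \<le> real (n * b0)"
    and "length p = n" "\<forall>c\<in>set p. 0 \<le> c \<and> c \<le> 1"
    and unc: "val (uncovered_t (rational_facets F) lattice_list \<mu> p)"
  shows "of_rat \<mu> \<le> \<nu>"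
proof (rule ccontr)
  assume "\<not> ?thesis"
  then have less: "\<nu> < of_rat \<mu>" by simp
  \<comment> \<open>Positivity selects the branch of the interior test that divides by
    \<mu>.\<close>
  then have "0 < \<mu>" using assms(1) by (metis of_rat_0 of_rat_less order_le_less_trans)
  let ?p = "list_vector (map of_rat p)"
  have p: "?p \<in> unit_cube n"
    using assms(4,5) by (auto simp: unit_cube_def list_vector_def real_space_iff)
  then obtain z where z: "z \<in> integer_lattice n" "covers \<nu> (?p - z)"
    using assms(2) unfolding lattice_covers_def unit_cube_def by blast
  have "lattice_coords z \<in> set lattice_list"
    by (rule lattice_coords_in_list[OF z(1) p z(2) assms(3)])
  then obtain f where "f \<in> set F" "of_rat \<mu> \<le> dotp n (normal f) (?p - z)"
    using unc val_uncovered_t[OF facets assms(4) \<open>0 < \<mu>\<close> length_lattice_list]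
    by (auto simp: list_vector_lattice_coords[OF z(1)] dest!: bspec[of _ _ "lattice_coords z"])
  with z(2) less show False by (force simp: covers_def)
qed

text \<open>The list contains lattice points only, so the test against it is implied by
  \<open>last_covered\<close>.\<close>

lemma last_covered_uncovered:
  assumes "last_covered (of_rat \<mu>) (list_vector (map of_rat p))" "0 \<le> \<mu>" "length p = n"
  shows "val (uncovered_t (rational_facets F) lattice_list \<mu> p)"
proof (cases "\<mu> = 0")
  case True
  then show ?thesis using uncovered_t_zero by simp
next
  case False
  have "list_vector (map of_rat z) \<in> integer_lattice n" if "z \<in> set lattice_list" for z
  proof -
    have z: "length z = n" "\<forall>c\<in>set z. \<exists>i. c = of_int i"
      using that by (auto simp: lattice_list_def val_lattice_points_t)
    have "list_vector (map of_rat z) j \<in> \<int>" if j: "j < n" for j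
    proof -
      obtain i where "z ! j = of_int i" using z j nth_mem[of j z] by blast
      then show ?thesis using z(1) j by (simp add: list_vector_def)
    qed
    then show ?thesis using z(1) by (simp add: integer_lattice_def list_vector_real_space)
  qed
  with assms False show ?thesis
    by (subst val_uncovered_t[OF facets]) (auto simp: last_covered_def length_lattice_list)
qed

lemma candidate_step_critical:
  assumes \<mu>: "0 \<le> \<mu>" "\<mu> \<le> real (n * b0)" and p: "last_covered \<mu> p" "p \<in> unit_cube n"
    and as: "length as = Suc n" "set as \<subseteq> active \<mu> p"
    and span: "affinely_spanning n (snd ` set as)"
  obtains q zs fs where "of_rat q = \<mu>" "zs \<in> set (val (tuples_t (n + 1) lattice_list))"
    "fs \<in> set (val (tuples_t (n + 1) (rational_facets F)))"
    "\<And>m. val (candidate_step_t n (rational_facets F) lattice_list zs fs m) = max q m"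
proof -
  \<comment> \<open>Several facets can share the same quotient a/b; any choice works, because the
    system is built from the quotients.\<close>
  define facet where "facet c = (SOME f. f \<in> set F \<and> normal f = c)" for c
  have facet: "facet (snd a) \<in> set F" "normal (facet (snd a)) = snd a" if "a \<in> set as" for a
  proof -
    have "snd a \<in> normal ` set F" using subsetD[OF as(2) that] by (cases a) (simp add: active_def)
    then have "\<exists>f. f \<in> set F \<and> normal f = snd a"
      by (rule imageE) (intro exI conjI, assumption, rule sym, assumption)
    from someI_ex[OF this] show "facet (snd a) \<in> set F" "normal (facet (snd a)) = snd a"
      by (simp_all add: facet_def)
  qed
  define c where "c a = map (\<lambda>x. x / of_int (snd (facet (snd a)))) (map rat_of_int (fst (facet (snd a))))" for a :: "(nat \<Rightarrow> real) \<times> (nat \<Rightarrow> real)"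
  have c: "length (c a) = n" "list_vector (map of_rat (c a)) = snd a" if "a \<in> set as" for a
    using facetD(1)[OF facet(1)[OF that]] facet(2)[OF that]
    by (simp_all only: c_def list_vector_rational_normal length_map)
  have rdot_c: "rdot (c a) v = dotp n (snd a) (list_vector v)" if "a \<in> set as" "length v = n" for a v
    using rdot_eq_dotp[of "c a" n v] c[OF that(1)] that(2) by simp
  define zs where "zs = map (\<lambda>a. lattice_coords (fst a)) as"
  define fs where "fs = map (\<lambda>a. (map rat_of_int (fst (facet (snd a))), rat_of_int (snd (facet (snd a))))) as"
  have act: "fst a \<in> integer_lattice n" "dotp n (snd a) (p - fst a) = \<mu>" "covers \<mu> (p - fst a)"
    if "a \<in> set as" for a
    using subsetD[OF as(2) that] by (simp_all add: active_def case_prod_unfold)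
  have zs: "zs \<in> set (val (tuples_t (n + 1) lattice_list))"
    unfolding val_tuples_t zs_def
    using lattice_coords_in_list[OF act(1) p(2) act(3) \<mu>(2)] as(1) by auto
  have "set fs \<subseteq> set (rational_facets F)"
  proof
    fix x assume "x \<in> set fs"
    then obtain a where a: "a \<in> set as"
      "x = (map rat_of_int (fst (facet (snd a))), rat_of_int (snd (facet (snd a))))"
      by (auto simp: fs_def)
    with facet(1)[OF a(1)] show "x \<in> set (rational_facets F)"
      by (auto simp: rational_facets_def case_prod_unfold)
  qed
  then have fs: "fs \<in> set (val (tuples_t (n + 1) (rational_facets F)))"
    using as(1) unfolding val_tuples_t by (simp add: fs_def)
  have cs: "scaled_normals fs = map c as"
    by (simp add: scaled_normals_def fs_def c_def)
  have sys: "critical_system (map c as) zs =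
      map (\<lambda>a. - 1 # c a @ [val (dot_t (c a) (lattice_coords (fst a)))]) as"
    by (simp add: critical_system_def zs_def zip_map_map zip_same_conv_map)
  \<comment> \<open>Common source of both independence facts: with \<open>t\<close> the value of the
    first row it gives affine independence, with \<open>t\<close> the entry of the unknown \<mu> it
    gives unique solvability.\<close>
  have kernel: "t = 0 \<and> set v \<subseteq> {0}" if "length v = n" "\<And>a. a \<in> set as \<Longrightarrow> rdot (c a) v = t" for t v
  proof -
    have "\<forall>c\<in>snd ` set as. dotp n c (list_vector v) = t"
      using rdot_c[OF _ that(1)] that(2) by simp
    then have "t = 0 \<and> list_vector v = 0"
      using span list_vector_real_space[OF that(1)] unfolding affinely_spanning_def by blast
    then show ?thesis by (simp add: list_vector_eq_0)
  qed
  obtain a0 as' where as': "as = a0 # as'" using as(1) by (cases as) auto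
  have c0: "length (c a0) = n" using c(1) by (simp add: as')
  have indep: "val (affinely_independent_t n (map c as))"
  proof -
    have "val (eliminate_t n (map (\<lambda>a. map2 (-) (c a) (c a0)) as')) \<noteq> None"
    proof (rule eliminate_not_None)
      show "length r = n" if r: "r \<in> set (map (\<lambda>a. map2 (-) (c a) (c a0)) as')" for r
      proof -
        obtain a where "a \<in> set as'" "r = map2 (-) (c a) (c a0)" using r unfolding set_map by blast
        with c(1)[of a] c0 show ?thesis by (simp add: as')
      qed
      fix v :: "real list"
      assume v: "length v = n" "\<And>r. r \<in> set (map (\<lambda>a. map2 (-) (c a) (c a0)) as') \<Longrightarrow> rdot r v = 0"
      have "rdot (c a) v = rdot (c a0) v" if a: "a \<in> set as" for a
      proof (cases "a \<in> set as'")
        case True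
        then have "rdot (map2 (-) (c a) (c a0)) v = 0" by (intro v(2)) auto
        moreover have "rdot (map2 (-) (c a) (c a0)) v = rdot (c a) v - rdot (c a0) v"
          using rdot_combination[of 1 "c a" "c a0" v] c(1)[OF a] c0 by simp
        ultimately show ?thesis by simp
      next
        case False
        with a have "a = a0" by (simp add: as')
        then show ?thesis by simp
      qed
      with kernel[OF v(1)] show "set v \<subseteq> {0}" by blast
    qed simp
    then show ?thesis by (simp add: affinely_independent_t_def as' comp_def)
  qed
  define pl where "pl = map p [0..<n]"
  have p_real: "p \<in> real_space n" using p(2) by (simp add: unit_cube_def)
  have pl: "length pl = n" "list_vector pl = p"
    by (simp_all add: pl_def list_vector_map_upt[OF p_real])
  \<comment> \<open>The expected solution (\<mu>, p) is handed to the elimination as a list of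
    reals; that its entries are rational is part of the result.\<close>
  have "\<exists>xs. val (solve_t (n + 1) (critical_system (map c as) zs)) = Some xs \<and> map of_rat xs = \<mu> # pl"
  proof (rule solve_eq_Some)
    show "length (\<mu> # pl) = n + 1" using pl by simp
    fix r assume "r \<in> set (critical_system (map c as) zs)"
    then obtain a where a: "a \<in> set as" "r = - 1 # c a @ [val (dot_t (c a) (lattice_coords (fst a)))]"
      by (auto simp: sys)
    have "of_rat (val (dot_t (c a) (lattice_coords (fst a)))) = dotp n (snd a) (fst a)"
      unfolding val_dot_t using rdot_c[OF a(1), of "map of_rat (lattice_coords (fst a))"]
        list_vector_lattice_coords[OF act(1)[OF a(1)]]
      by (simp add: lattice_coords_def del: map_map)
    moreover have "dotp n (snd a) p = \<mu> + dotp n (snd a) (fst a)"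
      using act(2)[OF a(1)] by (simp add: dotp_diff)
    ultimately show "length r = Suc (n + 1) \<and> rdot r ((\<mu> # pl) @ [- 1]) = 0"
      using a c(1)[OF a(1)] pl rdot_c[OF a(1) pl(1)] by (simp add: rdot_append of_rat_minus)
  next
    fix v :: "real list" assume v: "length v = n + 1" "\<And>r. r \<in> set (critical_system (map c as) zs) \<Longrightarrow> rdot r v = 0"
    then obtain t w where tw: "v = t # w" "length w = n" by (cases v) auto
    have "rdot (c a) w = t" if a: "a \<in> set as" for a
    proof -
      let ?s = "val (dot_t (c a) (lattice_coords (fst a)))"
      have "- 1 # c a @ [?s] \<in> set (critical_system (map c as) zs)"
        unfolding sys set_map using a by (rule image_eqI[OF refl])
      then have "rdot (- 1 # c a @ [?s]) (t # w) = 0" unfolding tw(1)[symmetric] by (rule v(2))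
      \<comment> \<open>The vector \<open>v\<close> is one entry shorter than the rows, so the
        right-hand side \<open>?s\<close> drops out.\<close>
      moreover have "rdot (c a @ [?s]) (w @ []) = rdot (c a) w + rdot [?s] []"
        by (rule rdot_append) (simp add: c(1)[OF a] tw(2))
      ultimately show ?thesis by (simp add: of_rat_minus)
    qed
    with kernel[OF tw(2), of t] show "set v \<subseteq> {0}" by (simp add: tw)
  qed
  then obtain q ps where sol: "val (solve_t (n + 1) (critical_system (map c as) zs)) = Some (q # ps)"
    and q: "of_rat q = \<mu>" and ps: "map of_rat ps = pl"
    by (metis map_eq_Cons_D)
  have cube: "0 \<le> x \<and> x \<le> 1" if "x \<in> set ps" for x
  proof -
    have "of_rat x \<in> set pl" using that unfolding ps[symmetric] by auto
    then obtain j where j: "j < n" "of_rat x = p j" by (auto simp: pl_def)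
    then have "0 \<le> p j \<and> p j \<le> 1" using p(2) by (simp add: unit_cube_def)
    then show ?thesis by (simp add: zero_le_of_rat_iff of_rat_le_1_iff flip: j(2))
  qed
  have "val (uncovered_t (rational_facets F) lattice_list q ps)"
  proof (rule last_covered_uncovered)
    show "length ps = n" using pl(1) by (metis length_map ps)
    show "0 \<le> q" using \<mu>(1) unfolding q[symmetric] by simp
    show "last_covered (of_rat q) (list_vector (map of_rat ps))" using p(1) by (simp add: q ps pl)
  qed
  then have "val (candidate_step_t n (rational_facets F) lattice_list zs fs m) = max q m" for m
    unfolding val_candidate_step_t cs sol using indep cube by simp
  with q zs fs show thesis by (rule that)
qed

lemma val_CoveringRadius: "of_rat (val (CoveringRadius n F)) = covering_radius n (polyhedron_of n F)"
proof -
  have pos: "0 < real (n * b0)" using n_ge b0_ge_1 by simp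
  obtain \<mu> p as where \<mu>: "0 \<le> \<mu>" "\<mu> \<le> real (n * b0)" and cov: "lattice_covers \<mu>"
    and p: "last_covered \<mu> p" "p \<in> unit_cube n" and as: "length as = Suc n" "set as \<subseteq> active \<mu> p"
    and span: "affinely_spanning n (snd ` set as)"
    by (rule exists_critical_point[OF pos]) (erule unit_cube_covered, rule that)
  obtain q zs fs where q: "of_rat q = \<mu>"
    and zs: "zs \<in> set (val (tuples_t (n + 1) lattice_list))"
    and fs: "fs \<in> set (val (tuples_t (n + 1) (rational_facets F)))"
    and crit: "\<And>m. val (candidate_step_t n (rational_facets F) lattice_list zs fs m) = max q m"
    using candidate_step_critical[OF \<mu> p as span] by blast
  have step: "m \<le> val (candidate_step_t n (rational_facets F) lattice_list ws gs m) \<and>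
      val (candidate_step_t n (rational_facets F) lattice_list ws gs m) \<le> q" if "m \<le> q" for m ws gs
  proof (cases rule: candidate_step_cases[of n "rational_facets F" lattice_list ws gs m])
    case 1
    with that show ?thesis by simp
  next
    case (2 \<nu> p')
    have "of_rat \<nu> \<le> \<mu>" using uncovered_le[OF \<mu>(1) cov \<mu>(2) 2(1-3)] .
    then have "\<nu> \<le> q" unfolding q[symmetric] by (simp add: of_rat_less_eq)
    with that 2(4) show ?thesis by simp
  qed
  let ?fss = "val (tuples_t (n + 1) (rational_facets F))"
  let ?loop = "\<lambda>ws. fold (\<lambda>gs m. val (candidate_step_t n (rational_facets F) lattice_list ws gs m)) ?fss"
  have "val (CoveringRadius n F) = fold ?loop (val (tuples_t (n + 1) lattice_list)) 0"
    using val_facet_norm_t[OF facets F_nonempty n_ge]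
    by (simp add: CoveringRadius_def CoveringRadius_param_def facet_norm_eq lattice_list_def M_def b0_def)
  also have "\<dots> = q"
  proof (rule fold_reaches[OF _ _ zs])
    show "m \<le> ?loop ws m \<and> ?loop ws m \<le> q" if "m \<le> q" for ws m
      by (rule fold_between) (use step that in auto)
    show "?loop zs m = q" if "m \<le> q" for m
      by (rule fold_reaches[OF _ _ fs]) (use step crit that in auto)
    show "0 \<le> q" using \<mu>(1) unfolding q[symmetric] by simp
  qed
  finally show ?thesis using covering_radius_eqI[OF \<mu>(1) cov p(1)] q by simp
qed

end

section \<open>Running time\<close>

lemma steps_map_t_le:
  "(\<And>x. x \<in> set xs \<Longrightarrow> steps (f x) \<le> c) \<Longrightarrow> steps (map_t f xs) \<le> length xs * (c + 1)"
proof (induction xs)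
  case (Cons x xs)
  have "steps (f x) \<le> c" "steps (map_t f xs) \<le> length xs * (c + 1)" using Cons by auto
  then show ?case by simp
qed simp

lemma steps_fold_t_le:
  "(\<And>x s. x \<in> set xs \<Longrightarrow> steps (f x s) \<le> c) \<Longrightarrow> steps (fold_t f xs s) \<le> length xs * (c + 1)"
proof (induction xs arbitrary: s)
  case (Cons x xs)
  have "steps (f x s) \<le> c" "steps (fold_t f xs (val (f x s))) \<le> length xs * (c + 1)"
    using Cons by auto
  then show ?case by simp
qed simp

lemma steps_all_t_le:
  "(\<And>x. x \<in> set xs \<Longrightarrow> steps (p x) \<le> c) \<Longrightarrow> steps (all_t p xs) \<le> length xs * (c + 1)"
proof (induction xs)
  case (Cons x xs)
  have "steps (p x) \<le> c" "steps (all_t p xs) \<le> length xs * (c + 1)" using Cons by auto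
  then show ?case by simp
qed simp

lemma steps_max_t [simp]: "steps (max_t x y) = 1"
  by (simp add: max_t_def)

lemma steps_abs_t_le: "steps (abs_t x) \<le> 2"
  by (simp add: abs_t_def)

lemma steps_power_t_le: "steps (power_t x k) \<le> 2 * k"
  unfolding power_t_def by (rule order_trans[OF steps_fold_t_le[where c = 1]]) auto

lemma steps_fact_t_le: "steps (fact_t k) \<le> 2 * k"
  unfolding fact_t_def by (rule order_trans[OF steps_fold_t_le[where c = 1]]) (auto simp del: upt_Suc)

lemma steps_diff_t_le: "steps (diff_t xs ys) \<le> 2 * length xs"
  unfolding diff_t_def by (rule order_trans[OF steps_map_t_le[where c = 1]]) auto

lemma steps_dot_t_le: "steps (dot_t xs ys) \<le> 3 * length xs"
  unfolding dot_t_def by (rule order_trans[OF steps_fold_t_le[where c = 2]]) auto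

lemma length_tuples_t: "length (val (tuples_t k xs)) = length xs ^ k"
proof (induction k)
  case (Suc k)
  then show ?case by (simp add: length_concat comp_def sum_list_triv)
qed simp

text \<open>Nonemptiness makes the powers increasing, so a stage costs at most
  \<open>2 * length xs ^ Suc k\<close> steps and every stage can be charged at the final
  power.\<close>

lemma steps_tuples_t_le:
  assumes "xs \<noteq> []"
  shows "steps (tuples_t k xs) \<le> 2 * k * length xs ^ k"
proof (induction k)
  case (Suc k)
  let ?q = "length xs"
  let ?ts = "val (tuples_t k xs)"
  have q: "1 \<le> ?q" using assms by (simp add: Suc_le_eq)
  have "steps (map_t (\<lambda>t. return (x # t)) ?ts) \<le> ?q ^ k" for x
    by (rule order_trans[OF steps_map_t_le[where c = 0]]) (auto simp: length_tuples_t)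
  then have "steps (map_t (\<lambda>x. map_t (\<lambda>t. return (x # t)) ?ts) xs) \<le> ?q * (?q ^ k + 1)"
    by (intro steps_map_t_le) auto
  also have "\<dots> \<le> ?q * (?q ^ k + ?q ^ k)" using q by (intro mult_le_mono add_le_mono) auto
  finally have 1: "steps (map_t (\<lambda>x. map_t (\<lambda>t. return (x # t)) ?ts) xs) \<le> 2 * ?q ^ Suc k"
    by (simp add: algebra_simps)
  have "2 * k * ?q ^ k \<le> 2 * k * ?q ^ Suc k" using q by (intro mult_le_mono power_increasing) auto
  with Suc have "steps (tuples_t k xs) \<le> 2 * k * ?q ^ Suc k" by (rule order_trans)
  with 1 have "steps (tuples_t (Suc k) xs) \<le> 2 * k * ?q ^ Suc k + 2 * ?q ^ Suc k"
    by (simp del: power_Suc)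
  also have "\<dots> = 2 * Suc k * ?q ^ Suc k" by (simp add: algebra_simps)
  finally show ?case .
qed simp

section \<open>Cost of Gaussian elimination\<close>

lemma steps_find_pivot_t_le: "steps (find_pivot_t A) \<le> length A"
  by (induction A) auto

lemma steps_reduce_row_t_le: "steps (reduce_row_t p r) \<le> 3 * length r + 1"
proof -
  have "steps (map_t (\<lambda>(x, y). (hd r / hd p) *\<^sub>t y \<bind> (\<lambda>z. x -\<^sub>t z)) (zip (tl r) (tl p))) \<le>
      length (zip (tl r) (tl p)) * (2 + 1)"
    by (rule steps_map_t_le) auto
  also have "\<dots> \<le> 3 * length r" by simp
  finally show ?thesis by (simp add: reduce_row_t_def)
qed

lemma eliminate_rows_length:
  "val (eliminate_t k A) = Some rs \<Longrightarrow> (\<And>r. r \<in> set A \<Longrightarrow> length r \<le> l) \<Longrightarrow> r \<in> set rs \<Longrightarrow> length r \<le> l"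
proof (induction k arbitrary: A rs)
  case (Suc k)
  then obtain p qs e where piv: "val (find_pivot_t A) = Some (p, qs)"
    and e: "val (eliminate_t k (map (\<lambda>r. val (reduce_row_t p r)) qs)) = Some e" "rs = p # e"
    by (auto simp: eliminate_Suc split: option.splits)
  have len: "length x \<le> l" if "x \<in> insert p (set qs)" for x
    using Suc.prems(2) find_pivot_Some[OF piv] that by blast
  have "length x \<le> l" if "x \<in> set (map (\<lambda>r. val (reduce_row_t p r)) qs)" for x
  proof -
    from that obtain y where "y \<in> set qs" "x = val (reduce_row_t p y)" by auto
    with len[of y] show ?thesis by (simp add: val_reduce_row_t)
  qed
  from Suc.IH[OF e(1) this] show ?case using Suc.prems(3) e(2) len[of p] by auto
qed simp

text \<open>Per column, at most \<open>a\<close> comparisons find the pivot, and at most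
  \<open>a\<close> rows cost \<open>3 * l + 1\<close> steps each plus one for the loop.\<close>

lemma steps_eliminate_t_le:
  "(\<And>r. r \<in> set A \<Longrightarrow> length r \<le> l) \<Longrightarrow> length A \<le> a \<Longrightarrow>
    steps (eliminate_t k A) \<le> k * (a * (3 * l + 3))"
proof (induction k arbitrary: A)
  case (Suc k)
  show ?case
  proof (cases "val (find_pivot_t A)")
    case None
    have "steps (eliminate_t (Suc k) A) \<le> length A"
      using None steps_find_pivot_t_le[of A] by (simp add: eliminate_t.simps(2))
    also have "\<dots> \<le> a * (3 * l + 3)" using mult_le_mono[OF Suc.prems(2), of 1 "3 * l + 3"] by simp
    also have "\<dots> \<le> Suc k * (a * (3 * l + 3))" by simp
    finally show ?thesis .
  next
    case (Some x)
    obtain p rs where x: "x = (p, rs)" by (cases x)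
    note piv = find_pivot_Some[OF Some[unfolded x]]
    have len: "length r \<le> l" if "r \<in> set rs" for r using Suc.prems(1) piv that by blast
    have "steps (reduce_row_t p r) \<le> 3 * l + 1" if "r \<in> set rs" for r
      using steps_reduce_row_t_le[of p r] len[OF that] by simp
    then have "steps (map_t (reduce_row_t p) rs) \<le> length rs * (3 * l + 1 + 1)"
      by (rule steps_map_t_le)
    moreover have "steps (find_pivot_t A) \<le> length A" by (rule steps_find_pivot_t_le)
    moreover have rs: "length rs \<le> a" using Suc.prems(2) piv by simp
    moreover note add_le_mono[OF Suc.prems(2) mult_le_mono1[OF rs, of "3 * l + 1 + 1"]]
    moreover have "steps (eliminate_t k (map (\<lambda>r. val (reduce_row_t p r)) rs)) \<le> k * (a * (3 * l + 3))"
    proof (rule Suc.IH)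
      fix r assume "r \<in> set (map (\<lambda>r. val (reduce_row_t p r)) rs)"
      then obtain y where "y \<in> set rs" "r = val (reduce_row_t p y)" by auto
      with len[of y] show "length r \<le> l" by (simp add: val_reduce_row_t)
    next
      show "length (map (\<lambda>r. val (reduce_row_t p r)) rs) \<le> a" using Suc.prems(2) piv by simp
    qed
    ultimately show ?thesis
      by (simp add: eliminate_t.simps(2) Some x algebra_simps)
  qed
qed simp

lemma steps_back_substitute_t_le:
  "(\<And>r. r \<in> set rs \<Longrightarrow> length r \<le> l) \<Longrightarrow> steps (back_substitute_t rs) \<le> length rs * (3 * l + 2)"
proof (induction rs)
  case (Cons r rs)
  have "steps (dot_t (butlast (tl r)) (val (back_substitute_t rs))) \<le> 3 * length (butlast (tl r))"
    by (rule steps_dot_t_le)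
  moreover have "length (butlast (tl r)) \<le> l" using Cons.prems[of r] by simp
  moreover have "steps (back_substitute_t rs) \<le> length rs * (3 * l + 2)" using Cons by auto
  ultimately show ?case by simp
qed simp

lemma steps_solve_t_le:
  assumes "\<And>r. r \<in> set A \<Longrightarrow> length r \<le> l" "length A \<le> a"
  shows "steps (solve_t k A) \<le> k * (a * (3 * l + 3)) + k * (3 * l + 2)"
proof (cases "val (eliminate_t k A)")
  case None
  with steps_eliminate_t_le[OF assms, of k] show ?thesis by (simp add: solve_t_def)
next
  case (Some rs)
  have "steps (back_substitute_t rs) \<le> k * (3 * l + 2)"
    using steps_back_substitute_t_le[of rs l] eliminate_rows_length[OF Some assms(1)] length_eliminate[OF Some]
    by simp
  with steps_eliminate_t_le[OF assms, of k] show ?thesis by (simp add: solve_t_def Some)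
qed

lemma steps_affinely_independent_t_le:
  assumes "length cs \<le> n + 1" "\<And>c. c \<in> set cs \<Longrightarrow> length c \<le> n"
  shows "steps (affinely_independent_t n cs) \<le> n * (2 * n + 1) + n * (n * (3 * n + 3))"
proof -
  have "steps (diff_t c (hd cs)) \<le> 2 * n" if "c \<in> set (tl cs)" for c
  proof -
    have "length c \<le> n" using assms(2) that by (cases cs) auto
    with steps_diff_t_le[of c "hd cs"] show ?thesis by linarith
  qed
  then have "steps (map_t (\<lambda>c. diff_t c (hd cs)) (tl cs)) \<le> length (tl cs) * (2 * n + 1)"
    by (rule steps_map_t_le)
  also have "\<dots> \<le> n * (2 * n + 1)" using assms(1) by (intro mult_le_mono) auto
  finally have 1: "steps (map_t (\<lambda>c. diff_t c (hd cs)) (tl cs)) \<le> n * (2 * n + 1)" .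
  have "length r \<le> n" if r: "r \<in> set (val (map_t (\<lambda>c. diff_t c (hd cs)) (tl cs)))" for r
  proof -
    obtain c where c: "c \<in> set (tl cs)" "r = val (diff_t c (hd cs))"
      using r unfolding val_map_t set_map by blast
    from c(1) have "length c \<le> n" using assms(2) by (cases cs) auto
    with c(2) show ?thesis by simp
  qed
  then have "steps (eliminate_t n (val (map_t (\<lambda>c. diff_t c (hd cs)) (tl cs)))) \<le> n * (n * (3 * n + 3))"
    using assms(1) by (intro steps_eliminate_t_le) auto
  with 1 show ?thesis by (simp add: affinely_independent_t_def)
qed

text \<open>Per lattice point: 2n for the difference, 1 for the zero test, 2n for the division, 1
  for the loop. Per facet: 3n for the product, then comparison and loop.\<close>

lemma steps_uncovered_t_le:
  assumes "length p = n" "\<And>a b. (a, b) \<in> set F \<Longrightarrow> length a \<le> n"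
  shows "steps (uncovered_t F L \<mu> p) \<le> length L * (4 * n + 2 + length F * (3 * n + 2))"
proof -
  have dot: "steps ((\<lambda>(a, b). dot_t a x \<bind> (\<lambda>s. s <\<^sub>t b)) f) \<le> 3 * n + 1" if "f \<in> set F" for f x
    using steps_dot_t_le[of "fst f" x] assms(2)[of "fst f" "snd f"] that by (simp add: case_prod_unfold)
  have "steps (in_interior_t F \<mu> y) \<le> 1 + 2 * length y + length F * (3 * n + 2)" for y
    using steps_map_t_le[of y "\<lambda>c. c /\<^sub>t \<mu>" 1] steps_all_t_le[of F, OF dot]
    by (simp add: in_interior_t_def add_le_mono)
  then have inside: "steps (in_interior_t F \<mu> y) \<le> 1 + 2 * n + length F * (3 * n + 2)" if "length y \<le> n" for y
    using that by (meson add_le_mono le_trans mult_le_mono2 order_refl)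
  have "steps (diff_t p z) + steps (in_interior_t F \<mu> (val (diff_t p z))) \<le>
      4 * n + 1 + length F * (3 * n + 2)" for z
    using steps_diff_t_le[of p z] inside[of "val (diff_t p z)"] assms(1) by simp
  then have "steps (uncovered_t F L \<mu> p) \<le> length L * (4 * n + 1 + length F * (3 * n + 2) + 1)"
    unfolding uncovered_t_def by (intro steps_all_t_le) simp
  then show ?thesis by simp
qed

text \<open>Elimination costs order n^3, the covering test order n times the number of translates
  times the number of facets; one product bounds both. The constants below add up to 6 + 9 + 8 + 70
  + 4 + 11 = 108.\<close>

lemma steps_candidate_step_t_le:
  assumes n: "1 \<le> n" and F: "\<And>a b. (a, b) \<in> set F \<Longrightarrow> length a = n" "F \<noteq> []" and L: "L \<noteq> []"
    and fs: "length fs = n + 1" "set fs \<subseteq> set F"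
  shows "steps (candidate_step_t n F L zs fs m) \<le> 110 * (n ^ 3 * length L * length F)"
proof -
  let ?X = "n ^ 3 * length L * length F"
  have lens: "1 \<le> length F" "1 \<le> length L" using F(2) L by (simp_all add: Suc_le_eq)
  have pow: "1 \<le> n ^ 2" "n \<le> n ^ 2" "n ^ 2 \<le> n ^ 3"
    using n power_increasing[of 1 2 n] power_increasing[of 2 3 n] by simp_all
  have X: "n ^ 3 \<le> ?X"
    using mult_le_mono[OF mult_le_mono[OF order_refl[of "n ^ 3"] lens(2)] lens(1)] by simp
  have len_fs: "length (fst f) = n" if "f \<in> set fs" for f using F(1)[of "fst f" "snd f"] fs(2) that by auto
  define cs where "cs = val (map_t (\<lambda>(a, b). map_t (\<lambda>c. c /\<^sub>t b) a) fs)"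
  have cs: "length cs = n + 1" "\<And>c. c \<in> set cs \<Longrightarrow> length c = n"
    using fs(1) len_fs by (auto simp: cs_def case_prod_unfold)
  have "steps ((\<lambda>(a, b). map_t (\<lambda>c. c /\<^sub>t b) a) f) \<le> 2 * n" if "f \<in> set fs" for f
    using steps_map_t_le[of "fst f" "\<lambda>c. c /\<^sub>t snd f" 1] len_fs[OF that] by (simp add: case_prod_unfold)
  then have "steps (map_t (\<lambda>(a, b). map_t (\<lambda>c. c /\<^sub>t b) a) fs) \<le> length fs * (2 * n + 1)"
    by (rule steps_map_t_le)
  also have "\<dots> = 2 * n ^ 2 + 3 * n + 1"
    unfolding fs(1) by (simp add: algebra_simps power2_eq_square power3_eq_cube)
  also have "\<dots> \<le> 6 * n ^ 3" using n pow by linarith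
  finally have 1: "steps (map_t (\<lambda>(a, b). map_t (\<lambda>c. c /\<^sub>t b) a) fs) \<le> 6 * n ^ 3" .
  have "steps (affinely_independent_t n cs) \<le> n * (2 * n + 1) + n * (n * (3 * n + 3))"
    using cs by (intro steps_affinely_independent_t_le) auto
  also have "\<dots> = 3 * n ^ 3 + 5 * n ^ 2 + n"
    by (simp add: algebra_simps power2_eq_square power3_eq_cube)
  also have "\<dots> \<le> 9 * n ^ 3" using n pow by linarith
  finally have 2: "steps (affinely_independent_t n cs) \<le> 9 * n ^ 3" .
  define row where "row = (\<lambda>(c :: rat list, z). dot_t c z \<bind> (\<lambda>s. return (- 1 # c @ [s])))"
  have "steps (row x) \<le> 3 * n" if "x \<in> set (zip cs zs)" for x
  proof -
    have "length (fst x) = n" using that set_zip_leftD[of "fst x" "snd x" cs zs] cs(2) by simp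
    with steps_dot_t_le[of "fst x" "snd x"] show ?thesis by (simp add: row_def case_prod_unfold)
  qed
  then have "steps (map_t row (zip cs zs)) \<le> length (zip cs zs) * (3 * n + 1)"
    by (rule steps_map_t_le)
  also have "\<dots> \<le> (n + 1) * (3 * n + 1)" using cs(1) by (intro mult_le_mono) auto
  also have "\<dots> = 3 * n ^ 2 + 4 * n + 1"
    by (simp add: algebra_simps power2_eq_square power3_eq_cube)
  also have "\<dots> \<le> 8 * n ^ 3" using n pow by linarith
  finally have 3: "steps (map_t row (zip cs zs)) \<le> 8 * n ^ 3" .
  define A where "A = val (map_t row (zip cs zs))"
  have A: "length r \<le> n + 2" if "r \<in> set A" for r
  proof -
    obtain x where x: "x \<in> set (zip cs zs)" "r = val (row x)"
      using \<open>r \<in> set A\<close> unfolding A_def val_map_t set_map by blast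
    then have "length (fst x) = n" using set_zip_leftD[of "fst x" "snd x" cs zs] cs(2) by simp
    with x(2) show ?thesis by (simp add: row_def case_prod_unfold)
  qed
  have "steps (solve_t (n + 1) A) \<le> (n + 1) * ((n + 1) * (3 * (n + 2) + 3)) + (n + 1) * (3 * (n + 2) + 2)"
    by (rule steps_solve_t_le[OF A]) (simp_all add: A_def cs(1))
  also have "\<dots> = 3 * n ^ 3 + 18 * n ^ 2 + 32 * n + 17"
    by (simp add: algebra_simps power2_eq_square power3_eq_cube)
  also have "\<dots> \<le> 70 * n ^ 3" using n pow by linarith
  finally have 4: "steps (solve_t (n + 1) A) \<le> 70 * n ^ 3" .
  \<comment> \<open>\<open>b\<close> and \<open>b'\<close> stand for the outcomes of the cube test
    and of the covering test.\<close>
  have 5: "steps (in_unit_cube_t p) + (if b then steps (uncovered_t F L \<mu> p) + (if b' then 1 else 0) else 0)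
      \<le> 4 * n ^ 3 + 11 * ?X" if "length p = n" for p \<mu> b b'
  proof -
    have "steps (in_unit_cube_t p) \<le> length p * (2 + 1)"
      unfolding in_unit_cube_t_def by (rule steps_all_t_le) simp
    moreover have "steps (uncovered_t F L \<mu> p) \<le> length L * (4 * n + 2 + length F * (3 * n + 2))"
      using F(1) by (intro steps_uncovered_t_le that) simp
    moreover have "4 * n + 2 + length F * (3 * n + 2) \<le> 11 * (n ^ 3 * length F)"
    proof -
      have "4 * n + 2 \<le> 6 * n ^ 3 * 1" using n pow by linarith
      also have "\<dots> \<le> 6 * n ^ 3 * length F" using lens(1) by (intro mult_le_mono) auto
      finally have "4 * n + 2 \<le> 6 * n ^ 3 * length F" .
      moreover have "length F * (3 * n + 2) \<le> length F * (5 * n ^ 3)"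
        using n pow by (intro mult_le_mono2) linarith
      ultimately show ?thesis by (simp add: algebra_simps)
    qed
    then have "length L * (4 * n + 2 + length F * (3 * n + 2)) \<le> length L * (11 * (n ^ 3 * length F))"
      by (rule mult_le_mono2)
    moreover have "\<dots> = 11 * ?X" by (simp add: algebra_simps)
    moreover have "3 * n + 1 \<le> 4 * n ^ 3" using n pow by linarith
    ultimately show ?thesis using that by (simp split: if_split)
  qed
  let ?test = "case val (solve_t (n + 1) A) of
      Some (\<mu> # p) \<Rightarrow> do { cube \<leftarrow> in_unit_cube_t p;
        if cube then do { unc \<leftarrow> uncovered_t F L \<mu> p; if unc then max_t \<mu> m else return m } else return m }
    | _ \<Rightarrow> return m"
  have 6: "steps ?test \<le> 4 * n ^ 3 + 11 * ?X"
  proof (cases "\<exists>\<mu> p. val (solve_t (n + 1) A) = Some (\<mu> # p)")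
    case True
    then obtain \<mu> p where sol: "val (solve_t (n + 1) A) = Some (\<mu> # p)" by blast
    have "length p = n" using length_solve[OF sol] by simp
    with 5[of p "val (in_unit_cube_t p)" \<mu> "val (uncovered_t F L \<mu> p)"] show ?thesis
      unfolding sol by (simp split: if_splits)
  next
    case False
    then show ?thesis by (auto split: option.split list.split)
  qed
  have "steps (candidate_step_t n F L zs fs m) \<le>
      steps (map_t (\<lambda>(a, b). map_t (\<lambda>c. c /\<^sub>t b) a) fs) + steps (affinely_independent_t n cs) +
      steps (map_t row (zip cs zs)) + steps (solve_t (n + 1) A) + steps ?test"
    unfolding candidate_step_t_def timed_simps cs_def[symmetric] row_def[symmetric]
    by (simp add: A_def[symmetric] del: val_map_t)
  also have "\<dots> \<le> 6 * n ^ 3 + 9 * n ^ 3 + 8 * n ^ 3 + 70 * n ^ 3 + (4 * n ^ 3 + 11 * ?X)"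
    by (intro add_le_mono 1 2 3 4 6)
  also have "\<dots> \<le> 110 * ?X" using X by linarith
  finally show ?thesis .
qed

section \<open>Total cost\<close>

lemma length_count_up_t: "length (val (count_up_t 0 (of_nat M))) = M + 1"
  by (simp add: val_count_up_t nat_add_distrib)

lemma steps_count_up_t: "steps (count_up_t k M) = 2 * length (val (count_up_t k M)) + 1"
proof (induction k M rule: count_up_t.induct)
  case (1 k M)
  then show ?case by (subst (1 2) count_up_t.simps) simp
qed

lemma length_lattice_points_t: "length (val (lattice_points_t n (of_nat M))) = (2 * (M + 1)) ^ n"
  by (simp add: lattice_points_t_def length_tuples_t length_count_up_t mult_2)

lemma steps_lattice_points_t_le:
  assumes "1 \<le> n"
  shows "steps (lattice_points_t n (of_nat M)) \<le> 6 * n * (2 * (M + 1)) ^ n"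
proof -
  let ?q = "2 * (M + 1)"
  let ?ks = "val (count_up_t 0 (of_nat M))"
  have "steps (map_t (\<lambda>k. 0 -\<^sub>t k) ?ks) \<le> ?q" "steps (map_t (\<lambda>k. k +\<^sub>t 1) ?ks) \<le> ?q"
    by (rule order_trans[OF steps_map_t_le[where c = 1]]; simp add: length_count_up_t)+
  moreover have "steps (tuples_t n (map (\<lambda>k. 0 - k) ?ks @ map (\<lambda>k. k + 1) ?ks)) \<le>
      2 * n * length (map (\<lambda>k. 0 - k) ?ks @ map (\<lambda>k. k + 1) ?ks) ^ n"
    using length_count_up_t[of M] by (intro steps_tuples_t_le) auto
  moreover have "length (map (\<lambda>k. 0 - k) ?ks @ map (\<lambda>k. k + 1) ?ks) = ?q"
    by (simp add: length_count_up_t)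
  moreover have "steps (count_up_t 0 (of_nat M)) = ?q + 1"
    by (simp add: steps_count_up_t length_count_up_t)
  ultimately have "steps (lattice_points_t n (of_nat M)) \<le> 3 * ?q + 1 + 2 * n * ?q ^ n"
    by (simp add: lattice_points_t_def)
  also have "\<dots> \<le> 4 * ?q ^ n + 2 * n * ?q ^ n"
    using self_le_power[of ?q n] assms by simp
  also have "\<dots> \<le> 4 * n * ?q ^ n + 2 * n * ?q ^ n" using assms by (intro add_le_mono mult_le_mono) auto
  finally show ?thesis by simp
qed

text \<open>With l lattice points and m facets there are l^(n+1) m^(n+1) candidates of order n^3 l m
  each, hence the exponent n + 2 on both. The constant rounds up 112 + 4 + 4 + 6 + 1.\<close>

lemma steps_CoveringRadius_param_le:
  assumes n: "1 \<le> n" and F: "\<And>a b. (a, b) \<in> set F \<Longrightarrow> length a = n" "F \<noteq> []"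
    and M: "\<mu>0 * \<beta>0 = of_nat M"
  shows "steps (CoveringRadius_param n F \<beta>0 \<mu>0) \<le>
    130 * (n ^ 3 * ((2 * (M + 1)) ^ n) ^ (n + 2) * length F ^ (n + 2))"
proof -
  define L where "L = val (lattice_points_t n (of_nat M))"
  let ?l = "length L" and ?m = "length F"
  let ?X = "n ^ 3 * ?l ^ (n + 2) * ?m ^ (n + 2)"
  have l: "?l = (2 * (M + 1)) ^ n" unfolding L_def by (rule length_lattice_points_t)
  then have L: "L \<noteq> []" by auto
  have ge1: "1 \<le> ?l" "1 \<le> ?m" using L F(2) by (simp_all add: Suc_le_eq)
  have n2: "2 * (n + 1) \<le> 4 * n" using n by simp
  have n3: "n \<le> n ^ 3" using self_le_power[OF n, of 3] by simp
  have X: "a * b * c \<le> ?X" if "a \<le> n ^ 3" "b \<le> ?l ^ (n + 2)" "c \<le> ?m ^ (n + 2)" for a b c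
    using that by (intro mult_le_mono)
  have pow: "?l ^ k \<le> ?l ^ (n + 2)" "?m ^ k \<le> ?m ^ (n + 2)" if "k \<le> n + 2" for k
    by (rule power_increasing[OF that ge1(1)], rule power_increasing[OF that ge1(2)])
  have one: "1 \<le> ?l ^ (n + 2)" "1 \<le> ?m ^ (n + 2)" "1 \<le> n ^ 3"
    using ge1 n by (auto intro: one_le_power)
  define zss fss where "zss = val (tuples_t (n + 1) L)" and "fss = val (tuples_t (n + 1) F)"
  have "steps (candidate_step_t n F L zs fs m) \<le> 110 * (n ^ 3 * ?l * ?m)" if "fs \<in> set fss" for zs fs m
    using that unfolding fss_def val_tuples_t by (intro steps_candidate_step_t_le n F L) auto
  then have "steps (fold_t (\<lambda>fs. candidate_step_t n F L zs fs) fss m) \<le> length fss * (110 * (n ^ 3 * ?l * ?m) + 1)"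
    for zs m by (rule steps_fold_t_le)
  then have "steps (fold_t (\<lambda>zs. fold_t (\<lambda>fs. candidate_step_t n F L zs fs) fss) zss 0) \<le>
      length zss * (length fss * (110 * (n ^ 3 * ?l * ?m) + 1) + 1)"
    by (rule steps_fold_t_le)
  also have "\<dots> = 110 * ?X + 1 * ?l ^ (n + 1) * ?m ^ (n + 1) + 1 * ?l ^ (n + 1) * 1"
    unfolding zss_def fss_def length_tuples_t by (simp add: algebra_simps)
  also have "\<dots> \<le> 110 * ?X + ?X + ?X"
    using pow[of "n + 1"] one by (intro add_le_mono X order_refl) auto
  also have "\<dots> = 112 * ?X" by linarith
  finally have loop: "steps (fold_t (\<lambda>zs. fold_t (\<lambda>fs. candidate_step_t n F L zs fs) fss) zss 0) \<le> 112 * ?X" .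
  have "steps (tuples_t (n + 1) L) \<le> 2 * (n + 1) * ?l ^ (n + 1)" by (rule steps_tuples_t_le[OF L])
  also have "\<dots> \<le> 4 * n * ?l ^ (n + 1)" by (rule mult_le_mono1[OF n2])
  also have "\<dots> = 4 * (n * ?l ^ (n + 1) * 1)" by simp
  also have "\<dots> \<le> 4 * ?X" using pow[of "n + 1"] one n3 by (intro mult_le_mono2 X) auto
  finally have tL: "steps (tuples_t (n + 1) L) \<le> 4 * ?X" .
  have "steps (tuples_t (n + 1) F) \<le> 2 * (n + 1) * ?m ^ (n + 1)" by (rule steps_tuples_t_le[OF F(2)])
  also have "\<dots> \<le> 4 * n * ?m ^ (n + 1)" by (rule mult_le_mono1[OF n2])
  also have "\<dots> = 4 * (n * 1 * ?m ^ (n + 1))" by simp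
  also have "\<dots> \<le> 4 * ?X" using pow[of "n + 1"] one n3 by (intro mult_le_mono2 X) auto
  finally have tF: "steps (tuples_t (n + 1) F) \<le> 4 * ?X" .
  have "steps (lattice_points_t n (of_nat M)) \<le> 6 * n * ?l"
    unfolding l by (rule steps_lattice_points_t_le[OF n])
  also have "\<dots> = 6 * (n * ?l ^ 1 * 1)" by simp
  also have "\<dots> \<le> 6 * ?X" using pow[of 1] one n3 by (intro mult_le_mono2 X) auto
  finally have lat: "steps (lattice_points_t n (of_nat M)) \<le> 6 * ?X" .
  have "1 * 1 * 1 \<le> ?X" using one by (intro X)
  with loop tL tF lat have "steps (CoveringRadius_param n F \<beta>0 \<mu>0) \<le> 130 * ?X"
    unfolding CoveringRadius_param_def timed_simps arith_timed_simps M L_def[symmetric]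
      zss_def[symmetric] fss_def[symmetric] by linarith
  then show ?thesis unfolding l .
qed

lemma steps_facet_norm_t_le:
  assumes "\<And>a b. (a, b) \<in> set F \<Longrightarrow> length a = n"
  shows "steps (facet_norm_t F) \<le> length F * (4 * n + 2)"
proof -
  have inner: "steps (fold_t (\<lambda>c t. abs_t c \<bind> (\<lambda>d. max_t d t)) a s) \<le> length a * (3 + 1)" for a s
    by (rule steps_fold_t_le) (simp add: steps_abs_t_le)
  have "steps ((\<lambda>(a, b) s. fold_t (\<lambda>c t. abs_t c \<bind> (\<lambda>d. max_t d t)) a s \<bind> max_t b) f s) \<le> 4 * n + 1"
    if "f \<in> set F" for f s
    using inner[of "fst f" s] assms[of "fst f" "snd f"] that by (simp add: case_prod_unfold)
  note step = this
  show ?thesis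
    unfolding facet_norm_t_def
    by (rule order_trans[OF steps_fold_t_le[where c = "4 * n + 1"]]) (erule step, simp)
qed

text \<open>142 = 130 + 6 + 2 + 2 + 2: the parametrised algorithm, the facet norm, the power, the
  factorial, and two multiplications.\<close>

lemma steps_CoveringRadius_le:
  assumes n: "1 \<le> n" and F: "integer_facet_description n F" "F \<noteq> []"
    and N: "val (facet_norm_t (rational_facets F)) = of_nat N"
  defines "b \<equiv> N ^ n * fact n"
  shows "steps (CoveringRadius n F) \<le>
    142 * (n ^ 3 * ((2 * (n * b * b + 1)) ^ n) ^ (n + 2) * length F ^ (n + 2))"
proof -
  let ?R = "rational_facets F"
  let ?X = "n ^ 3 * ((2 * (n * b * b + 1)) ^ n) ^ (n + 2) * length F ^ (n + 2)"
  have R: "\<And>a b. (a, b) \<in> set ?R \<Longrightarrow> length a = n" "?R \<noteq> []" "length ?R = length F"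
    using F by (auto simp: rational_facets_def integer_facet_description_def)
  have m: "1 \<le> length F" using F(2) by (simp add: Suc_le_eq)
  have "n * 1 * length F \<le> ?X"
    using n m by (intro mult_le_mono self_le_power one_le_power) auto
  then have nm: "n * length F \<le> ?X" by simp
  have n': "n \<le> n * length F" using m by simp
  have "steps (facet_norm_t ?R) \<le> length F * (4 * n + 2)"
    using steps_facet_norm_t_le[of ?R n, OF R(1)] R(3) by simp
  also have "\<dots> \<le> length F * (6 * n)" using n by (intro mult_le_mono2) simp
  finally have 1: "steps (facet_norm_t ?R) \<le> 6 * (n * length F)" by (simp add: mult_ac)
  have "of_nat n * (of_nat N ^ n * fact n) * (of_nat N ^ n * fact n) = (of_nat (n * b * b) :: rat)"
    by (simp add: b_def)
  from steps_CoveringRadius_param_le[OF n R(1,2) this]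
  have "steps (CoveringRadius_param n ?R (of_nat N ^ n * fact n) (of_nat n * (of_nat N ^ n * fact n))) \<le> 130 * ?X"
    by (simp only: R(3))
  with 1 nm n' n steps_power_t_le[of "of_nat N" n] steps_fact_t_le[of n] show ?thesis
    unfolding CoveringRadius_def timed_simps arith_timed_simps val_power_t val_fact_t N
    by linarith
qed

text \<open>Bernoulli's inequality (1 + 1/n)^k \<ge> 1 + k/n with the denominators cleared.\<close>

lemma power_Suc_mult_ge: "n ^ k * (n + k) \<le> (n + 1) ^ k * (n :: nat)"
proof (induction k)
  case (Suc k)
  have "n ^ Suc k * (n + Suc k) \<le> n ^ k * ((n + 1) * (n + k))" by (simp add: algebra_simps)
  also have "\<dots> \<le> (n + 1) * ((n + 1) ^ k * n)" using mult_le_mono2[OF Suc, of "n + 1"] by (simp only: mult_ac)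
  finally show ?case by (simp only: power_Suc mult_ac)
qed simp

lemma two_power_self_le: "1 \<le> n \<Longrightarrow> 2 * n ^ n \<le> (n + 1) ^ (n :: nat)"
  using power_Suc_mult_ge[of n n] by (simp add: mult_2[symmetric] mult.assoc[symmetric] mult.commute[of _ "2 :: nat"])

text \<open>The factor 3 is a reserve which, raised to the power n (n + 2), absorbs n^3 in
  \<open>fact_power_le\<close>. The base case reads 654 \<le> 729; for n = 2 the inequality fails.
  In the step the left side grows by a factor of at most 4 (n + 1)^2, and the right side by at least
  as much, by \<open>two_power_self_le\<close>.\<close>

lemma fact_square_le: "3 \<le> n \<Longrightarrow> 3 * (2 * n * (fact n)\<^sup>2 + 2) \<le> (n ^ (2 * n) :: nat)"
proof (induction n rule: dec_induct)
  case base
  show ?case by (simp add: eval_nat_numeral)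
next
  case (step n)
  let ?f = "(fact n :: nat)\<^sup>2"
  have "2 * (n + 1) * ((n + 1)\<^sup>2 * ?f) + 2 \<le> 8 * n * ((n + 1)\<^sup>2 * ?f) + 2 * 4 * (n + 1)\<^sup>2"
    using step.hyps by (intro add_le_mono mult_le_mono1) (auto simp: power2_eq_square)
  also have "\<dots> = 4 * (n + 1)\<^sup>2 * (2 * n * ?f + 2)" by (simp add: algebra_simps)
  finally have "3 * (2 * (n + 1) * ((n + 1)\<^sup>2 * ?f) + 2) \<le> 3 * (4 * (n + 1)\<^sup>2 * (2 * n * ?f + 2))"
    by (rule mult_le_mono2)
  also have "\<dots> = 4 * (n + 1)\<^sup>2 * (3 * (2 * n * ?f + 2))" by (simp only: mult_ac)
  also have "\<dots> \<le> 4 * (n + 1)\<^sup>2 * n ^ (2 * n)" by (rule mult_le_mono2[OF step.IH])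
  also have "\<dots> = (n + 1)\<^sup>2 * (2 * n ^ n)\<^sup>2" by (simp add: power_mult_distrib power_mult[symmetric] mult.commute[of n 2])
  also have "\<dots> \<le> (n + 1)\<^sup>2 * ((n + 1) ^ n)\<^sup>2"
    using two_power_self_le[of n] step.hyps by (intro mult_le_mono2 power_mono) auto
  also have "\<dots> = (n + 1) ^ (2 * (n + 1))" by (simp add: power_add[symmetric] power_mult[symmetric] mult.commute)
  finally have "3 * (2 * (n + 1) * ((n + 1)\<^sup>2 * ?f) + 2) \<le> (n + 1) ^ (2 * (n + 1))" .
  moreover have "(fact (Suc n) :: nat) = (n + 1) * fact n" by simp
  ultimately show ?case by (simp only: power_mult_distrib Suc_eq_plus1)
qed

text \<open>
  By Stirling's formula \<open>2 n (n!)\<^sup>2 / n\<^sup>2\<^sup>n\<close> decays exponentially, so that only small \<open>n\<close> matter for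
  the constant.
\<close>

lemma fact_power_le:
  assumes "1 \<le> n"
  shows "n ^ 3 * (2 * n * (fact n)\<^sup>2 + 2) ^ (n * (n + 2)) \<le> 64 * (n ^ (2 * n)) ^ (n * (n + 2) :: nat)"
proof -
  \<comment> \<open>At n = 1 both sides equal 4^3 = 64, which is where the constant comes from; n =
    2 leaves room.\<close>
  consider "n = 1" | "n = 2" | "3 \<le> n" using assms by linarith
  then show ?thesis
  proof cases
    case 3
    let ?e = "n * (n + 2)" and ?r = "2 * n * (fact n)\<^sup>2 + 2 :: nat"
    have "n \<le> 2 ^ n" by (rule less_imp_le[OF less_exp])
    also have "\<dots> \<le> 3 ^ n" by (rule power_mono) auto
    finally have "n ^ 3 \<le> (3 ^ n) ^ 3" by (rule power_mono) simp
    also have "\<dots> = (3 :: nat) ^ (n * 3)" by (simp add: power_mult)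
    also have "\<dots> \<le> 3 ^ ?e" using 3 by (intro power_increasing mult_le_mono2) auto
    finally have "n ^ 3 * ?r ^ ?e \<le> 3 ^ ?e * ?r ^ ?e" by (rule mult_le_mono1)
    also have "\<dots> = (3 * ?r) ^ ?e" by (simp only: power_mult_distrib)
    also have "\<dots> \<le> (n ^ (2 * n)) ^ ?e" by (intro power_mono fact_square_le 3) simp
    finally show ?thesis by simp
  qed (simp_all add: fact_numeral)
qed

text \<open>Since N \<ge> 1, the number 2 (M + 1) of values per coordinate is at most N^(2n) times a
  quantity depending on n alone; N then carries exactly the stated exponent, and the rest is
  \<open>fact_power_le\<close>.\<close>

lemma running_time_le:
  fixes N n :: nat
  assumes "1 \<le> n" "1 \<le> N"
  defines "b \<equiv> N ^ n * fact n"
  shows "n ^ 3 * ((2 * (n * b * b + 1)) ^ n) ^ (n + 2) \<le> 64 * (N * n) ^ (2 * n\<^sup>2 * (n + 2))"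
proof -
  let ?e = "n * (n + 2)" and ?r = "2 * n * (fact n)\<^sup>2 + 2 :: nat"
  have "2 * (n * b * b + 1) = N ^ (2 * n) * (2 * n * (fact n)\<^sup>2) + 1 * 2"
    by (simp add: b_def power_mult power2_eq_square algebra_simps power_mult_distrib)
  also have "\<dots> \<le> N ^ (2 * n) * (2 * n * (fact n)\<^sup>2) + N ^ (2 * n) * 2"
    using assms(2) by (intro add_le_mono mult_le_mono1 one_le_power) auto
  also have "\<dots> = N ^ (2 * n) * ?r" by (simp only: distrib_left)
  finally have "((2 * (n * b * b + 1)) ^ n) ^ (n + 2) \<le> (N ^ (2 * n) * ?r) ^ ?e"
    unfolding power_mult[symmetric] by (intro power_mono) auto
  then have "n ^ 3 * ((2 * (n * b * b + 1)) ^ n) ^ (n + 2) \<le> n ^ 3 * (N ^ (2 * n) * ?r) ^ ?e"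
    by (rule mult_le_mono2)
  also have "\<dots> = (N ^ (2 * n)) ^ ?e * (n ^ 3 * ?r ^ ?e)" by (simp only: power_mult_distrib mult_ac)
  also have "\<dots> \<le> (N ^ (2 * n)) ^ ?e * (64 * (n ^ (2 * n)) ^ ?e)"
    by (intro mult_le_mono2 fact_power_le assms)
  also have "\<dots> = 64 * ((N * n) ^ (2 * n)) ^ ?e" by (simp only: power_mult_distrib mult_ac)
  also have "((N * n) ^ (2 * n)) ^ ?e = (N * n) ^ (2 * n\<^sup>2 * (n + 2))"
    unfolding power_mult[symmetric] by (simp add: power2_eq_square mult_ac)
  finally show ?thesis .
qed

theorem theorem3p4:
  shows "\<exists>C::real. \<forall>(n::nat) (F :: int facet list).
    n \<ge> 1 \<longrightarrow>
    integer_facet_description n F \<longrightarrow>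
    bounded_set n (polyhedron_of n F) \<longrightarrow>
      of_rat (val (CoveringRadius n F)) = covering_radius n (polyhedron_of n F) \<and>
      real (steps (CoveringRadius n F))
        \<le> C * (of_int (facet_norm F) * real n) ^ (2 * n^2 * (n + 2)) * real (length F) ^ (n + 2)"
proof (intro exI[of _ "142 * 64"] allI impI conjI)
  fix n F
  assume n: "n \<ge> 1" and F: "integer_facet_description n F" and bd: "bounded_set n (polyhedron_of n F)"
  interpret bounded_integer_polytope n F by standard (rule n F bd)+
  show "of_rat (val (CoveringRadius n F)) = covering_radius n (polyhedron_of n F)"
    by (rule val_CoveringRadius)
  let ?E = "2 * n\<^sup>2 * (n + 2)"
  have "val (facet_norm_t (rational_facets F)) = of_nat N"
    using val_facet_norm_t[OF F F_nonempty n] by (simp add: facet_norm_eq)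
  from steps_CoveringRadius_le[OF n F F_nonempty this]
  have "steps (CoveringRadius n F) \<le>
      142 * (n ^ 3 * ((2 * (n * b0 * b0 + 1)) ^ n) ^ (n + 2) * length F ^ (n + 2))"
    by (simp only: b0_def)
  also have "\<dots> \<le> 142 * (64 * (N * n) ^ ?E * length F ^ (n + 2))"
    unfolding b0_def by (intro mult_le_mono2 mult_le_mono1 running_time_le n N_ge_1)
  finally have "real (steps (CoveringRadius n F)) \<le> real (142 * (64 * (N * n) ^ ?E * length F ^ (n + 2)))"
    by (rule of_nat_mono)
  then show "real (steps (CoveringRadius n F)) \<le>
      142 * 64 * (of_int (facet_norm F) * real n) ^ ?E * real (length F) ^ (n + 2)"
    unfolding facet_norm_eq by simp
qed

end
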